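(* Let $\mathcal{P}:\mathbb{C}^{\mathrm{op}}\to\mathbf{Pos}$ be an indexed frame. Then the category $\mathbb{C}\langle\mathcal{P}\rangle$ of partial equivalence relations in $\mathcal{P}$ and compatible maps, equipped with the class of fibrations (morphisms satisfying (fib)) and the class of weak equivalences (morphisms satisfying (inj) and (esurj)), is a category of fibrant objects.
   Context: **Indexed frames.** An indexed poset on a category $\mathbb{C}$ is a functor $\mathcal{A}:\mathbb{C}^{\mathrm{op}}\to\mathbf{Pos}$ to posets and monotone maps (default size convention: $\mathbb{C}$ and the posets are small); for $f:J\to I$ write $f^*=\mathcal{A}(f):\mathcal{A}(I)\to\mathcal{A}(J)$; elements of $\mathcal{A}(I)$ are called predicates on $I$. It is an indexed meet-semilattice if every $\mathcal{A}(I)$ has finite meets (including a greatest element $\top$) and all $f^*$ preserve them. An indexed frame is an indexed meet-semilattice $\mathcal{P}$ on a category $\mathbb{C}$ with finite limits such that: (Ex) every $f^*$ has a left adjoint $\exists_f$; (Fr) $(\exists_f\varphi)\wedge\psi=\exists_f(\varphi\wedge f^*\psi)$ for $f:J\to I$, $\varphi\in\mathcal{P}(J)$, $\psi\in\mathcal{P}(I)$; (BC) $\exists_h\circ k^*=f^*\circ\exists_g$ for every pullback square in $\mathbb{C}$ with $fh=gk$, $h:D\to A$, $k:D\to B$, $f:A\to C$, $g:B\to C$. **Internal language.** Sorts are objects of $\mathbb{C}$; function symbols of arity $A_1,\dots,A_n\to B$ are morphisms $A_1\times\dots\times A_n\to B$; relation symbols of arity $A_1,\dots,A_n$ are elements of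 $\mathcal{P}(A_1\times\dots\times A_n)$. Formulas are built from $\varphi(\vec t)$ and $s=t$ using $\wedge,\top,\exists$. For a context $\vec x=x_1,\dots,x_n$ of distinct variables let $\mathfrak{s}(\vec x)$ be the product of the sorts. Terms $t$ in context $\vec x$ are interpreted as morphisms $[\![t]\!]_{\vec x}$ out of $\mathfrak{s}(\vec x)$ (variables as projections, application as composition), formulas as predicates on $\mathfrak{s}(\vec x)$: $[\![\varphi(t_1,\dots,t_n)]\!]_{\vec x}=\langle[\![t_1]\!]_{\vec x},\dots,[\![t_n]\!]_{\vec x}\rangle^*\varphi$; $[\![t=u]\!]_{\vec x}=\langle[\![t]\!]_{\vec x},[\![u]\!]_{\vec x}\rangle^*(\exists_\delta\top)$ with $\delta$ the diagonal; $\wedge,\top$ are interpreted fiberwise; $[\![\exists y.\,P]\!]_{\vec x}=\exists_\pi[\![P]\!]_{\vec x,y}$ with $\pi:\mathfrak{s}(\vec x)\times\mathfrak{s}(y)\to\mathfrak{s}(\vec x)$ the projection. A judgment $P_1,\dots,P_n\vdash_{\vec x}Q$ holds if $[\![P_1]\!]_{\vec x}\wedge\dots\wedge[\![P_n]\!]_{\vec x}\le[\![Q]\!]_{\vec x}$. **The category $\mathbb{C}\langle\mathcal{P}\rangle$.** Objects are pairs $(A,\rho)$ with $A\in\mathbb{C}$ and $\rho\in\mathcal{P}(A\times A)$ a partial equivalence relation, i.e. $\rho(x,y)\vdash_{x,y}\rho(y,x)$ and $\rho(x,y),\rho(y,z)\vdash_{x,y,z}\rho(x,z)$ hold. Morphisms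 $(A,\rho)\to(B,\sigma)$ are maps $f:A\to B$ in $\mathbb{C}$ such that $\rho(x,y)\vdash_{x,y}\sigma(fx,fy)$ holds; composition and identities are those of $\mathbb{C}$. We abbreviate $\rho(x,x)$ by $\rho x$. **Fibrations and weak equivalences.** A morphism $f:(A,\rho)\to(B,\sigma)$ is a fibration if (fib) $\rho x,\sigma(fx,u)\vdash_{x,u}\exists y.\,\rho(x,y)\wedge fy=u$ holds. It is a weak equivalence if (inj) $\rho x,\sigma(fx,fy),\rho y\vdash_{x,y}\rho(x,y)$ and (esurj) $\sigma u\vdash_u\exists x.\,\rho x\wedge\sigma(fx,u)$ hold. **Category of fibrant objects.** A category $\mathcal{C}$ with finite products and two classes of morphisms, fibrations $\mathcal{F}$ and weak equivalences $\mathcal{W}$ (morphisms in $\mathcal{F}\cap\mathcal{W}$ are trivial fibrations) such that: (A) isomorphisms are weak equivalences, and if two of $f,g,gf$ are weak equivalences (for composable $f,g$) then so is the third; (B) fibrations contain all isomorphisms and are closed under composition; (C) pullbacks of fibrations along arbitrary maps exist and are fibrations, and pullbacks of trivial fibrations are trivial fibrations; (D) for every $X$ the diagonal factors as $X\xrightarrow{s}P(X)\xrightarrow{d}X\times X$ with $s\in\mathcal{W}$, $d\in\mathcal{F}$; (E) every $X\to1$ is a fibration. *)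

theory Defs
  imports "HOL-Algebra.Galois_Connection"
begin

section \<open>Categories\<close>

record ('o, 'm) cat =
  Ob :: "'o set"
  Ar :: "'m set"
  Src :: "'m \<Rightarrow> 'o"
  Tgt :: "'m \<Rightarrow> 'o"
  Idn :: "'o \<Rightarrow> 'm"
  Cmp :: "'m \<Rightarrow> 'm \<Rightarrow> 'm" (infixr \<open>\<cdot>\<index>\<close> 70)

definition Mor :: "('o, 'm, 'z) cat_scheme \<Rightarrow> 'o \<Rightarrow> 'o \<Rightarrow> 'm set" where
  "Mor C A B = {f \<in> Ar C. Src C f = A \<and> Tgt C f = B}"

locale category =
  fixes C :: "('o, 'm, 'z) cat_scheme" (structure)
  assumes Src_Ob: "f \<in> Ar C \<Longrightarrow> Src C f \<in> Ob C"
    and Tgt_Ob: "f \<in> Ar C \<Longrightarrow> Tgt C f \<in> Ob C"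
    and Idn_Mor: "A \<in> Ob C \<Longrightarrow> Idn C A \<in> Mor C A A"
    and Cmp_Mor: "\<lbrakk>f \<in> Mor C X Y; g \<in> Mor C Y Z\<rbrakk> \<Longrightarrow> g \<cdot> f \<in> Mor C X Z"
    and Cmp_Idn: "f \<in> Mor C X Y \<Longrightarrow> f \<cdot> Idn C X = f"
    and Idn_Cmp: "f \<in> Mor C X Y \<Longrightarrow> Idn C Y \<cdot> f = f"
    and Cmp_assoc: "\<lbrakk>f \<in> Mor C X Y; g \<in> Mor C Y Z; h \<in> Mor C Z V\<rbrakk> \<Longrightarrow>
      (h \<cdot> g) \<cdot> f = h \<cdot> (g \<cdot> f)"

definition is_iso :: "('o, 'm, 'z) cat_scheme \<Rightarrow> 'm \<Rightarrow> bool" where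
  "is_iso C f \<longleftrightarrow> f \<in> Ar C \<and>
    (\<exists>g \<in> Mor C (Tgt C f) (Src C f).
       g \<cdot>\<^bsub>C\<^esub> f = Idn C (Src C f) \<and> f \<cdot>\<^bsub>C\<^esub> g = Idn C (Tgt C f))"

definition is_terminal :: "('o, 'm, 'z) cat_scheme \<Rightarrow> 'o \<Rightarrow> bool" where
  "is_terminal C T \<longleftrightarrow> T \<in> Ob C \<and> (\<forall>X \<in> Ob C. \<exists>!f. f \<in> Mor C X T)"

definition is_product ::
  "('o, 'm, 'z) cat_scheme \<Rightarrow> 'i set \<Rightarrow> ('i \<Rightarrow> 'o) \<Rightarrow> 'o \<Rightarrow> ('i \<Rightarrow> 'm) \<Rightarrow> bool" where
  "is_product C I X Q p \<longleftrightarrow> Q \<in> Ob C \<and> (\<forall>i\<in>I. p i \<in> Mor C Q (X i)) \<and>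
    (\<forall>Z \<in> Ob C. \<forall>u. (\<forall>i\<in>I. u i \<in> Mor C Z (X i)) \<longrightarrow>
       (\<exists>!h. h \<in> Mor C Z Q \<and> (\<forall>i\<in>I. p i \<cdot>\<^bsub>C\<^esub> h = u i)))"

definition has_finite_products :: "('o, 'm, 'z) cat_scheme \<Rightarrow> bool" where
  "has_finite_products C \<longleftrightarrow>
    (\<forall>I :: nat set. finite I \<longrightarrow>
      (\<forall>X. (\<forall>i\<in>I. X i \<in> Ob C) \<longrightarrow> (\<exists>Q p. is_product C I X Q p)))"

definition is_pullback ::
  "('o, 'm, 'z) cat_scheme \<Rightarrow> 'm \<Rightarrow> 'm \<Rightarrow> 'm \<Rightarrow> 'm \<Rightarrow> bool" where
  \<comment> \<open>the square \<open>f \<cdot> h = g \<cdot> k\<close> with \<open>h : D \<rightarrow> A\<close>, \<open>k : D \<rightarrow> B\<close>, \<open>f : A \<rightarrow> C\<close>, \<open>g : B \<rightarrow> C\<close>\<close>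
  "is_pullback C f g h k \<longleftrightarrow>
    f \<in> Ar C \<and> g \<in> Ar C \<and> h \<in> Ar C \<and> k \<in> Ar C \<and>
    Tgt C f = Tgt C g \<and> Src C h = Src C k \<and> Tgt C h = Src C f \<and> Tgt C k = Src C g \<and>
    f \<cdot>\<^bsub>C\<^esub> h = g \<cdot>\<^bsub>C\<^esub> k \<and>
    (\<forall>Z \<in> Ob C. \<forall>u \<in> Mor C Z (Src C f). \<forall>v \<in> Mor C Z (Src C g).
       f \<cdot>\<^bsub>C\<^esub> u = g \<cdot>\<^bsub>C\<^esub> v \<longrightarrow>
       (\<exists>!w. w \<in> Mor C Z (Src C h) \<and> h \<cdot>\<^bsub>C\<^esub> w = u \<and> k \<cdot>\<^bsub>C\<^esub> w = v))"

definition is_functor ::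
  "('a, 'b, 'y) cat_scheme \<Rightarrow> ('o, 'm, 'z) cat_scheme \<Rightarrow> ('a \<Rightarrow> 'o) \<Rightarrow> ('b \<Rightarrow> 'm) \<Rightarrow> bool" where
  "is_functor J C D E \<longleftrightarrow>
    (\<forall>a \<in> Ob J. D a \<in> Ob C) \<and>
    (\<forall>e \<in> Ar J. E e \<in> Mor C (D (Src J e)) (D (Tgt J e))) \<and>
    (\<forall>a \<in> Ob J. E (Idn J a) = Idn C (D a)) \<and>
    (\<forall>d \<in> Ar J. \<forall>e \<in> Ar J. Tgt J d = Src J e \<longrightarrow> E (e \<cdot>\<^bsub>J\<^esub> d) = E e \<cdot>\<^bsub>C\<^esub> E d)"

definition is_cone ::
  "('a, 'b, 'y) cat_scheme \<Rightarrow> ('o, 'm, 'z) cat_scheme \<Rightarrow> ('a \<Rightarrow> 'o) \<Rightarrow> ('b \<Rightarrow> 'm) \<Rightarrow>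
   'o \<Rightarrow> ('a \<Rightarrow> 'm) \<Rightarrow> bool" where
  "is_cone J C D E L l \<longleftrightarrow> L \<in> Ob C \<and> (\<forall>a \<in> Ob J. l a \<in> Mor C L (D a)) \<and>
    (\<forall>e \<in> Ar J. E e \<cdot>\<^bsub>C\<^esub> l (Src J e) = l (Tgt J e))"

definition is_limit ::
  "('a, 'b, 'y) cat_scheme \<Rightarrow> ('o, 'm, 'z) cat_scheme \<Rightarrow> ('a \<Rightarrow> 'o) \<Rightarrow> ('b \<Rightarrow> 'm) \<Rightarrow>
   'o \<Rightarrow> ('a \<Rightarrow> 'm) \<Rightarrow> bool" where
  "is_limit J C D E L l \<longleftrightarrow> is_cone J C D E L l \<and>
    (\<forall>Z u. is_cone J C D E Z u \<longrightarrow>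
       (\<exists>!h. h \<in> Mor C Z L \<and> (\<forall>a \<in> Ob J. l a \<cdot>\<^bsub>C\<^esub> h = u a)))"

text \<open>Every finite category is isomorphic to one whose objects and arrows are natural numbers,
  so it is enough to consider index categories of that type.\<close>

definition has_finite_limits :: "('o, 'm, 'z) cat_scheme \<Rightarrow> bool" where
  "has_finite_limits C \<longleftrightarrow>
    (\<forall>(J :: (nat, nat) cat) D E.
       category J \<and> finite (Ob J) \<and> finite (Ar J) \<and> is_functor J C D E \<longrightarrow>
       (\<exists>L l. is_limit J C D E L l))"

text \<open>To speak of \<open>A\<^sub>1 \<times> \<dots> \<times> A\<^sub>n\<close> we fix an arbitrary choice of finite products, for lists of
  objects.  The product of a one-element list is the object itself, so that a morphism
  \<open>A \<rightarrow> B\<close> is a function symbol of arity \<open>A \<rightarrow> B\<close>.\<close>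

record ('o, 'm) pcat = "('o, 'm) cat" +
  Prod :: "'o list \<Rightarrow> 'o"
  Proj :: "'o list \<Rightarrow> nat \<Rightarrow> 'm"

definition chosen_products :: "('o, 'm, 'z) pcat_scheme \<Rightarrow> bool" where
  "chosen_products C \<longleftrightarrow>
    (\<forall>As. set As \<subseteq> Ob C \<longrightarrow>
       is_product C {..<length As} (\<lambda>i. As ! i) (Prod C As) (Proj C As)) \<and>
    (\<forall>A \<in> Ob C. Prod C [A] = A \<and> Proj C [A] 0 = Idn C A)"

definition tuple :: "('o, 'm, 'z) pcat_scheme \<Rightarrow> 'o \<Rightarrow> 'm list \<Rightarrow> 'm" where
  \<comment> \<open>\<open>\<langle>m\<^sub>1, \<dots>, m\<^sub>n\<rangle> : X \<rightarrow> A\<^sub>1 \<times> \<dots> \<times> A\<^sub>n\<close> for \<open>m\<^sub>i : X \<rightarrow> A\<^sub>i\<close>\<close>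
  "tuple C X ms = (THE h. h \<in> Mor C X (Prod C (map (Tgt C) ms)) \<and>
     (\<forall>i < length ms. Proj C (map (Tgt C) ms) i \<cdot>\<^bsub>C\<^esub> h = ms ! i))"


section \<open>Indexed frames\<close>

record ('o, 'm, 'p) idx =
  Fib :: "'o \<Rightarrow> 'p gorder"
  Reidx :: "'m \<Rightarrow> 'p \<Rightarrow> 'p"

locale indexed_poset = category C
  for C :: "('o, 'm, 'z) cat_scheme" (structure) +
  fixes P :: "('o, 'm, 'p) idx"
  assumes Fib_poset: "I \<in> Ob C \<Longrightarrow> partial_order (Fib P I)"
    and Reidx_closed: "\<lbrakk>f \<in> Mor C J I; x \<in> carrier (Fib P I)\<rbrakk> \<Longrightarrow> Reidx P f x \<in> carrier (Fib P J)"
    and Reidx_mono: "f \<in> Mor C J I \<Longrightarrow> isotone (Fib P I) (Fib P J) (Reidx P f)"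
    and Reidx_Idn: "\<lbrakk>I \<in> Ob C; x \<in> carrier (Fib P I)\<rbrakk> \<Longrightarrow> Reidx P (Idn C I) x = x"
    and Reidx_Cmp: "\<lbrakk>f \<in> Mor C K J; g \<in> Mor C J I; x \<in> carrier (Fib P I)\<rbrakk> \<Longrightarrow>
      Reidx P (g \<cdot> f) x = Reidx P f (Reidx P g x)"

locale indexed_meet_semilattice = indexed_poset +
  assumes Fib_meets: "I \<in> Ob C \<Longrightarrow> lower_semilattice (Fib P I)"
    and Fib_top: "I \<in> Ob C \<Longrightarrow> \<exists>t. greatest (Fib P I) t (carrier (Fib P I))"
    and Reidx_meet: "\<lbrakk>f \<in> Mor C J I; x \<in> carrier (Fib P I); y \<in> carrier (Fib P I)\<rbrakk> \<Longrightarrow>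
      Reidx P f (x \<sqinter>\<^bsub>Fib P I\<^esub> y) = Reidx P f x \<sqinter>\<^bsub>Fib P J\<^esub> Reidx P f y"
    and Reidx_top: "f \<in> Mor C J I \<Longrightarrow> Reidx P f \<top>\<^bsub>Fib P I\<^esub> = \<top>\<^bsub>Fib P J\<^esub>"

definition left_adjoint_at ::
  "('o, 'm, 'z) cat_scheme \<Rightarrow> ('o, 'm, 'p) idx \<Rightarrow> 'm \<Rightarrow> ('p \<Rightarrow> 'p) \<Rightarrow> bool" where
  "left_adjoint_at C P f e \<longleftrightarrow>
    galois_connection \<lparr>orderA = Fib P (Src C f), orderB = Fib P (Tgt C f),
                       lower = e, upper = Reidx P f\<rparr>"

text \<open>Adjoints between posets are unique on the carrier, which makes the choice harmless.\<close>

definition Exq :: "('o, 'm, 'z) cat_scheme \<Rightarrow> ('o, 'm, 'p) idx \<Rightarrow> 'm \<Rightarrow> 'p \<Rightarrow> 'p" where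
  "Exq C P f = (SOME e. left_adjoint_at C P f e)"

locale indexed_frame = indexed_meet_semilattice +
  assumes finite_limits: "has_finite_limits C"
    and Ex: "f \<in> Ar C \<Longrightarrow> \<exists>e. left_adjoint_at C P f e"
    and Fr: "\<lbrakk>f \<in> Mor C J I; x \<in> carrier (Fib P J); y \<in> carrier (Fib P I)\<rbrakk> \<Longrightarrow>
      Exq C P f x \<sqinter>\<^bsub>Fib P I\<^esub> y = Exq C P f (x \<sqinter>\<^bsub>Fib P J\<^esub> Reidx P f y)"
    and BC: "\<lbrakk>is_pullback C f g h k; x \<in> carrier (Fib P (Src C g))\<rbrakk> \<Longrightarrow>
      Exq C P h (Reidx P k x) = Reidx P f (Exq C P g x)"


section \<open>Internal language\<close>

text \<open>The variables of a context are numbered \<open>0, 1, \<dots>\<close> from left to right, so a context is the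
  list of the sorts of its variables.  In a context of length \<open>n\<close>, \<open>Exi A \<phi>\<close> binds the
  variable \<open>n\<close> (of sort \<open>A\<close>) in \<open>\<phi>\<close>.  The interpretation is intended for well-sorted terms and
  formulas only.\<close>

datatype 'm tm = Var nat | Fn 'm "'m tm list"

datatype ('o, 'm, 'p) fm =
    Rel 'p "'m tm list"
  | Equ "'m tm" "'m tm"
  | Top
  | And "('o, 'm, 'p) fm" "('o, 'm, 'p) fm"
  | Exi 'o "('o, 'm, 'p) fm"

fun tm_int :: "('o, 'm, 'z) pcat_scheme \<Rightarrow> 'o list \<Rightarrow> 'm tm \<Rightarrow> 'm" where
  "tm_int C \<Gamma> (Var i) = Proj C \<Gamma> i"
| "tm_int C \<Gamma> (Fn f ts) = f \<cdot>\<^bsub>C\<^esub> tuple C (Prod C \<Gamma>) (map (tm_int C \<Gamma>) ts)"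

definition diag :: "('o, 'm, 'z) pcat_scheme \<Rightarrow> 'o \<Rightarrow> 'm" where
  "diag C A = tuple C A [Idn C A, Idn C A]"

definition ctx_proj :: "('o, 'm, 'z) pcat_scheme \<Rightarrow> 'o list \<Rightarrow> 'o \<Rightarrow> 'm" where
  "ctx_proj C \<Gamma> A = tuple C (Prod C (\<Gamma> @ [A])) (map (Proj C (\<Gamma> @ [A])) [0..<length \<Gamma>])"

fun fm_int ::
  "('o, 'm, 'z) pcat_scheme \<Rightarrow> ('o, 'm, 'p) idx \<Rightarrow> 'o list \<Rightarrow> ('o, 'm, 'p) fm \<Rightarrow> 'p" where
  "fm_int C P \<Gamma> (Rel r ts) = Reidx P (tuple C (Prod C \<Gamma>) (map (tm_int C \<Gamma>) ts)) r"
| "fm_int C P \<Gamma> (Equ t u) =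
     (let A = Tgt C (tm_int C \<Gamma> t) in
       Reidx P (tuple C (Prod C \<Gamma>) [tm_int C \<Gamma> t, tm_int C \<Gamma> u])
         (Exq C P (diag C A) \<top>\<^bsub>Fib P A\<^esub>))"
| "fm_int C P \<Gamma> Top = \<top>\<^bsub>Fib P (Prod C \<Gamma>)\<^esub>"
| "fm_int C P \<Gamma> (And \<phi> \<psi>) = fm_int C P \<Gamma> \<phi> \<sqinter>\<^bsub>Fib P (Prod C \<Gamma>)\<^esub> fm_int C P \<Gamma> \<psi>"
| "fm_int C P \<Gamma> (Exi A \<phi>) = Exq C P (ctx_proj C \<Gamma> A) (fm_int C P (\<Gamma> @ [A]) \<phi>)"

definition entails ::
  "('o, 'm, 'z) pcat_scheme \<Rightarrow> ('o, 'm, 'p) idx \<Rightarrow> 'o list \<Rightarrow>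
   ('o, 'm, 'p) fm list \<Rightarrow> ('o, 'm, 'p) fm \<Rightarrow> bool" where
  \<comment> \<open>\<open>\<phi>\<^sub>1, \<dots>, \<phi>\<^sub>n \<turnstile>\<^sub>\<Gamma> \<psi>\<close>\<close>
  "entails C P \<Gamma> \<phi>s \<psi> \<longleftrightarrow>
    fm_int C P \<Gamma> (foldr And \<phi>s Top) \<sqsubseteq>\<^bsub>Fib P (Prod C \<Gamma>)\<^esub> fm_int C P \<Gamma> \<psi>"


section \<open>The category of partial equivalence relations\<close>

definition is_per ::
  "('o, 'm, 'z) pcat_scheme \<Rightarrow> ('o, 'm, 'p) idx \<Rightarrow> 'o \<Rightarrow> 'p \<Rightarrow> bool" where
  "is_per C P A \<rho> \<longleftrightarrow> \<rho> \<in> carrier (Fib P (Prod C [A, A])) \<and>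
    (let x = Var 0; y = Var 1; z = Var 2 in
      entails C P [A, A] [Rel \<rho> [x, y]] (Rel \<rho> [y, x]) \<and>
      entails C P [A, A, A] [Rel \<rho> [x, y], Rel \<rho> [y, z]] (Rel \<rho> [x, z]))"

definition compatible ::
  "('o, 'm, 'z) pcat_scheme \<Rightarrow> ('o, 'm, 'p) idx \<Rightarrow> 'o \<times> 'p \<Rightarrow> 'o \<times> 'p \<Rightarrow> 'm \<Rightarrow> bool" where
  "compatible C P = (\<lambda>(A, \<rho>) (B, \<sigma>) f. f \<in> Mor C A B \<and>
    (let x = Var 0; y = Var 1 in
      entails C P [A, A] [Rel \<rho> [x, y]] (Rel \<sigma> [Fn f [x], Fn f [y]])))"

text \<open>The same \<open>f\<close> can be a morphism between several pairs of objects, so arrows are triples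
  consisting of source, underlying map and target.\<close>

definition per_cat ::
  "('o, 'm, 'z) pcat_scheme \<Rightarrow> ('o, 'm, 'p) idx \<Rightarrow>
   ('o \<times> 'p, ('o \<times> 'p) \<times> 'm \<times> ('o \<times> 'p)) cat" where
  "per_cat C P = (let Obj = {(A, \<rho>). A \<in> Ob C \<and> is_per C P A \<rho>} in
    \<lparr>Ob = Obj,
     Ar = {(X, f, Y). X \<in> Obj \<and> Y \<in> Obj \<and> compatible C P X Y f},
     Src = (\<lambda>(X, f, Y). X),
     Tgt = (\<lambda>(X, f, Y). Y),
     Idn = (\<lambda>X. (X, Idn C (fst X), X)),
     Cmp = (\<lambda>(_, g, Z) (X, f, _). (X, g \<cdot>\<^bsub>C\<^esub> f, Z))\<rparr>)"

definition fib ::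
  "('o, 'm, 'z) pcat_scheme \<Rightarrow> ('o, 'm, 'p) idx \<Rightarrow> 'o \<times> 'p \<Rightarrow> 'm \<Rightarrow> 'o \<times> 'p \<Rightarrow> bool" where
  "fib C P = (\<lambda>(A, \<rho>) f (B, \<sigma>).
    let x = Var 0; u = Var 1; y = Var 2 in
      entails C P [A, B] [Rel \<rho> [x, x], Rel \<sigma> [Fn f [x], u]]
        (Exi A (And (Rel \<rho> [x, y]) (Equ (Fn f [y]) u))))"

definition weq_inj ::
  "('o, 'm, 'z) pcat_scheme \<Rightarrow> ('o, 'm, 'p) idx \<Rightarrow> 'o \<times> 'p \<Rightarrow> 'm \<Rightarrow> 'o \<times> 'p \<Rightarrow> bool" where
  "weq_inj C P = (\<lambda>(A, \<rho>) f (B, \<sigma>).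
    let x = Var 0; y = Var 1 in
      entails C P [A, A] [Rel \<rho> [x, x], Rel \<sigma> [Fn f [x], Fn f [y]], Rel \<rho> [y, y]]
        (Rel \<rho> [x, y]))"

definition weq_esurj ::
  "('o, 'm, 'z) pcat_scheme \<Rightarrow> ('o, 'm, 'p) idx \<Rightarrow> 'o \<times> 'p \<Rightarrow> 'm \<Rightarrow> 'o \<times> 'p \<Rightarrow> bool" where
  "weq_esurj C P = (\<lambda>(A, \<rho>) f (B, \<sigma>).
    let u = Var 0; x = Var 1 in
      entails C P [B] [Rel \<sigma> [u, u]]
        (Exi A (And (Rel \<rho> [x, x]) (Rel \<sigma> [Fn f [x], u]))))"

definition fibrations ::
  "('o, 'm, 'z) pcat_scheme \<Rightarrow> ('o, 'm, 'p) idx \<Rightarrow> (('o \<times> 'p) \<times> 'm \<times> ('o \<times> 'p)) set" where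
  "fibrations C P = {(X, f, Y). (X, f, Y) \<in> Ar (per_cat C P) \<and> fib C P X f Y}"

definition weak_equivalences ::
  "('o, 'm, 'z) pcat_scheme \<Rightarrow> ('o, 'm, 'p) idx \<Rightarrow> (('o \<times> 'p) \<times> 'm \<times> ('o \<times> 'p)) set" where
  "weak_equivalences C P =
    {(X, f, Y). (X, f, Y) \<in> Ar (per_cat C P) \<and> weq_inj C P X f Y \<and> weq_esurj C P X f Y}"


section \<open>Categories of fibrant objects\<close>

locale category_of_fibrant_objects = category C
  for C :: "('o, 'm, 'z) cat_scheme" (structure) +
  fixes F W :: "'m set"
  assumes F_Ar: "F \<subseteq> Ar C"
    and W_Ar: "W \<subseteq> Ar C"
    and finite_products: "has_finite_products C"
    and A_iso: "is_iso C f \<Longrightarrow> f \<in> W"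
    and A_comp: "\<lbrakk>f \<in> Mor C X Y; g \<in> Mor C Y Z; f \<in> W; g \<in> W\<rbrakk> \<Longrightarrow> g \<cdot> f \<in> W"
    and A_left: "\<lbrakk>f \<in> Mor C X Y; g \<in> Mor C Y Z; f \<in> W; g \<cdot> f \<in> W\<rbrakk> \<Longrightarrow> g \<in> W"
    and A_right: "\<lbrakk>f \<in> Mor C X Y; g \<in> Mor C Y Z; g \<in> W; g \<cdot> f \<in> W\<rbrakk> \<Longrightarrow> f \<in> W"
    and B_iso: "is_iso C f \<Longrightarrow> f \<in> F"
    and B_comp: "\<lbrakk>f \<in> Mor C X Y; g \<in> Mor C Y Z; f \<in> F; g \<in> F\<rbrakk> \<Longrightarrow> g \<cdot> f \<in> F"
    and C_ex: "\<lbrakk>f \<in> Mor C A B; g \<in> Mor C D B; g \<in> F\<rbrakk> \<Longrightarrow> \<exists>h k. is_pullback C f g h k"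
    and C_fib: "\<lbrakk>is_pullback C f g h k; g \<in> F\<rbrakk> \<Longrightarrow> h \<in> F"
    and C_triv: "\<lbrakk>is_pullback C f g h k; g \<in> F \<inter> W\<rbrakk> \<Longrightarrow> h \<in> F \<inter> W"
    and D: "\<lbrakk>X \<in> Ob C; is_product C {0, 1 :: nat} (\<lambda>_. X) Q p;
             \<delta> \<in> Mor C X Q; p 0 \<cdot> \<delta> = Idn C X; p 1 \<cdot> \<delta> = Idn C X\<rbrakk> \<Longrightarrow>
      \<exists>PX \<in> Ob C. \<exists>s \<in> Mor C X PX. \<exists>d \<in> Mor C PX Q. s \<in> W \<and> d \<in> F \<and> d \<cdot> s = \<delta>"
    and E: "\<lbrakk>is_terminal C T; f \<in> Mor C X T\<rbrakk> \<Longrightarrow> f \<in> F"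

end

theory Submission
  imports Defs
begin

text \<open>
  Every axiom of a category of fibrant objects is proved for \<open>\<complex>\<langle>P\<rangle>\<close> as it would be for sets with
  partial equivalence relations: pick elements, chase them through the maps, and use symmetry and
  transitivity.  What has to be justified is that one may argue with elements.

  An element of \<open>A\<close> at a stage \<open>(K, c)\<close> is a morphism \<open>K \<rightarrow> A\<close>, and a predicate \<open>\<phi>\<close> on \<open>A\<close> holds of it
  if \<open>c\<close> lies below the reindexing of \<open>\<phi>\<close>.  Stages are refined by reindexing, and a refinement
  \<open>p : (L, d) \<rightarrow> (K, c)\<close> is a cover if \<open>c \<le> \<exists>\<^sub>p d\<close>.  As in Kripke-Joyal semantics, \<open>\<and>\<close> and \<open>\<top>\<close> are
  interpreted naively, while an existential statement asks for a witness on some cover and an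
  equation asks for equality of morphisms on some cover.  The only nontrivial point is the
  existential quantifier (\<open>holds_Exq\<close>), where the witness is the universal one, living on a
  pullback; the Beck-Chevalley condition and Frobenius reciprocity say precisely that this pullback
  covers.  It follows that a judgment is valid if and only if it is valid for all elements at all
  stages (\<open>entails_iff_forces\<close>), and the definitions of objects, morphisms, fibrations and weak
  equivalences turn into their set-theoretic counterparts, with witnesses on covers.

  The elementwise arguments are then as follows.  Two out of three: chase preimages given by
  essential surjectivity.  Pullbacks: the pullback in the base category, related componentwise,
  is a pullback; given elements \<open>x\<close> of the pullback and \<open>a\<close> of \<open>X\<close> related to the image of \<open>x\<close>, a
  fibration moves the other component of \<open>x\<close> so that it lies exactly over \<open>f a\<close>, and it forms with
  \<open>a\<close> an element of the pullback (\<open>pullback_fibn\<close>, \<open>pullback_weq\<close>).  Finite products are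
  iterated pullbacks over the terminal object.  Path objects: the elements of \<open>X \<times> X\<close> whose two
  components are related (\<open>path_obj_fibn\<close>, \<open>path_obj_weq\<close>).
\<close>


section \<open>Arrows and pullbacks in a category\<close>

lemma MorD:
  assumes "f \<in> Mor C A B"
  shows "f \<in> Ar C" "Src C f = A" "Tgt C f = B"
  using assms by (simp_all add: Mor_def)

context category
begin

lemma Mor_Ob:
  assumes "f \<in> Mor C A B"
  shows "A \<in> Ob C" "B \<in> Ob C"
  using assms Src_Ob Tgt_Ob by (auto simp: Mor_def)

lemma is_pullbackI:
  assumes "f \<in> Mor C A B" "g \<in> Mor C D B" "h \<in> Mor C Q A" "k \<in> Mor C Q D" "f \<cdot> h = g \<cdot> k"
    and "\<And>Z u v. \<lbrakk>u \<in> Mor C Z A; v \<in> Mor C Z D; f \<cdot> u = g \<cdot> v\<rbrakk> \<Longrightarrow>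
      \<exists>w. w \<in> Mor C Z Q \<and> h \<cdot> w = u \<and> k \<cdot> w = v"
    and "\<And>Z w w'. \<lbrakk>w \<in> Mor C Z Q; w' \<in> Mor C Z Q; h \<cdot> w = h \<cdot> w'; k \<cdot> w = k \<cdot> w'\<rbrakk> \<Longrightarrow> w = w'"
  shows "is_pullback C f g h k"
proof -
  have "\<exists>!w. w \<in> Mor C Z Q \<and> h \<cdot> w = u \<and> k \<cdot> w = v"
    if "u \<in> Mor C Z A" "v \<in> Mor C Z D" "f \<cdot> u = g \<cdot> v" for Z u v
    using assms(6)[OF that] assms(7) by (auto intro: ex_ex1I)
  then show ?thesis
    using MorD[OF assms(1)] MorD[OF assms(2)] MorD[OF assms(3)] MorD[OF assms(4)] assms(5)
    unfolding is_pullback_def by simp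
qed

lemma pullbackD:
  assumes "is_pullback C f g h k"
  obtains A B D Q where "f \<in> Mor C A B" "g \<in> Mor C D B" "h \<in> Mor C Q A" "k \<in> Mor C Q D"
    "f \<cdot> h = g \<cdot> k"
  using assms by (auto simp: is_pullback_def Mor_def)

lemma pullback_lift:
  assumes "is_pullback C f g h k" "u \<in> Mor C Z (Src C f)" "v \<in> Mor C Z (Src C g)" "f \<cdot> u = g \<cdot> v"
  shows "\<exists>!w. w \<in> Mor C Z (Src C h) \<and> h \<cdot> w = u \<and> k \<cdot> w = v"
  using assms Mor_Ob(1)[OF assms(2)] unfolding is_pullback_def by blast

text \<open>Any two pullbacks of the same cospan differ by an isomorphism, which is why stability
  properties have to be checked for one choice of pullback only.\<close>

lemma pullback_unique_iso:
  assumes pb: "is_pullback C f g h k" and pb': "is_pullback C f g h' k'"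
  obtains i where "is_iso C i" "i \<in> Mor C (Src C h) (Src C h')" "h' \<cdot> i = h" "k' \<cdot> i = k"
proof -
  have comparison: "\<exists>i. i \<in> Mor C (Src C h) (Src C h') \<and> h' \<cdot> i = h \<and> k' \<cdot> i = k"
    if "is_pullback C f g h k" "is_pullback C f g h' k'" for h k h' k'
  proof -
    have "h \<in> Mor C (Src C h) (Src C f)" "k \<in> Mor C (Src C h) (Src C g)" "f \<cdot> h = g \<cdot> k"
      using that(1) by (auto simp: is_pullback_def Mor_def)
    from pullback_lift[OF that(2) this] show ?thesis by blast
  qed
  have round_trip: "j \<cdot> i = Idn C (Src C h)"
    if pb: "is_pullback C f g h k"
      and i: "i \<in> Mor C (Src C h) (Src C h')" "h' \<cdot> i = h" "k' \<cdot> i = k"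
      and j: "j \<in> Mor C (Src C h') (Src C h)" "h \<cdot> j = h'" "k \<cdot> j = k'" for h k h' k' i j
  proof -
    have hk: "h \<in> Mor C (Src C h) (Src C f)" "k \<in> Mor C (Src C h) (Src C g)" "f \<cdot> h = g \<cdot> k"
      using that(1) by (auto simp: is_pullback_def Mor_def)
    have "h \<cdot> (j \<cdot> i) = h" "k \<cdot> (j \<cdot> i) = k"
      using Cmp_assoc[OF i(1) j(1) hk(1)] Cmp_assoc[OF i(1) j(1) hk(2)] i j by simp_all
    moreover have "j \<cdot> i \<in> Mor C (Src C h) (Src C h)" using Cmp_Mor i j by blast
    moreover have "Idn C (Src C h) \<in> Mor C (Src C h) (Src C h)"
      using Idn_Mor Mor_Ob(1)[OF hk(1)] by blast
    moreover have "h \<cdot> Idn C (Src C h) = h" "k \<cdot> Idn C (Src C h) = k"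
      using Cmp_Idn hk by blast+
    ultimately show ?thesis using pullback_lift[OF pb hk] by blast
  qed
  obtain i where i: "i \<in> Mor C (Src C h) (Src C h')" "h' \<cdot> i = h" "k' \<cdot> i = k"
    using comparison[OF pb pb'] by blast
  obtain j where j: "j \<in> Mor C (Src C h') (Src C h)" "h \<cdot> j = h'" "k \<cdot> j = k'"
    using comparison[OF pb' pb] by blast
  have "is_iso C i"
    unfolding is_iso_def
    using round_trip[OF pb i j] round_trip[OF pb' j i] i(1) j(1) by (auto simp: Mor_def)
  with i show ?thesis using that by blast
qed

text \<open>A pullback is the limit of a functor on the walking cospan \<open>0 \<rightarrow> 2 \<leftarrow> 1\<close>; below its
  arrows are numbered so that \<open>0, 1, 2\<close> are the identities.\<close>

lemma finite_limits_pullback: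
  assumes lim: "has_finite_limits C"
    and f: "f \<in> Mor C A B" and g: "g \<in> Mor C D B"
  obtains h k where "is_pullback C f g h k"
proof -
  define J :: "(nat, nat) cat" where "J = \<lparr>Ob = {0, 1, 2}, Ar = {0, 1, 2, 3, 4},
    Src = (\<lambda>e. if e = 3 then 0 else if e = 4 then 1 else e), Tgt = (\<lambda>e. if e \<ge> 3 then 2 else e),
    Idn = (\<lambda>a. a), Cmp = (\<lambda>e d. if e \<le> 2 then d else e)\<rparr>"
  define D' where "D' = (\<lambda>a :: nat. if a = 0 then A else if a = 1 then D else B)"
  define E where "E = (\<lambda>e :: nat. if e = 3 then f else if e = 4 then g else Idn C (D' e))"
  have J: "category J"
    by unfold_locales (auto simp: J_def Mor_def split: if_splits)
  have Ob: "A \<in> Ob C" "B \<in> Ob C" "D \<in> Ob C" using f g Mor_Ob by auto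
  have D': "D' a \<in> Ob C" for a using Ob by (simp add: D'_def)
  have E: "E e \<in> Mor C (D' (Src J e)) (D' (Tgt J e))" if "e \<in> Ar J" for e
    using that f g Idn_Mor[OF D', of e] by (auto simp: J_def E_def D'_def)
  have E_Cmp: "E (e \<cdot>\<^bsub>J\<^esub> d) = E e \<cdot> E d" if "d \<in> Ar J" "e \<in> Ar J" "Tgt J d = Src J e" for d e
  proof (cases "e \<le> 2")
    case True
    with that have "e = Tgt J d" "e \<cdot>\<^bsub>J\<^esub> d = d" "E e = Idn C (D' e)"
      by (auto simp: J_def E_def)
    then show ?thesis using Idn_Cmp[OF E[OF that(1)]] by simp
  next
    case False
    with that have "d = Src J e" "e \<cdot>\<^bsub>J\<^esub> d = e" "E d = Idn C (D' d)"
      by (auto simp: J_def E_def split: if_splits)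
    then show ?thesis using Cmp_Idn[OF E[OF that(2)]] by simp
  qed
  have F: "is_functor J C D' E"
    using D' E E_Cmp by (simp add: is_functor_def) (simp add: J_def E_def)
  have "finite (Ob J)" "finite (Ar J)" by (simp_all add: J_def)
  with J F obtain Q l where l: "is_limit J C D' E Q l"
    using lim unfolding has_finite_limits_def by blast
  have cone: "is_cone J C D' E Z u \<longleftrightarrow> u 0 \<in> Mor C Z A \<and> u 1 \<in> Mor C Z D \<and>
    u 2 = f \<cdot> u 0 \<and> f \<cdot> u 0 = g \<cdot> u 1" for Z u
    using Ob f g Cmp_Mor Idn_Cmp Mor_Ob Idn_Cmp[OF Cmp_Mor[OF _ f]] Idn_Cmp[OF Cmp_Mor[OF _ g]]
    by (auto simp: is_cone_def J_def D'_def E_def)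
  have l': "l 0 \<in> Mor C Q A" "l 1 \<in> Mor C Q D" "l 2 = f \<cdot> l 0" "f \<cdot> l 0 = g \<cdot> l 1"
    using l unfolding is_limit_def cone by auto
  have "is_pullback C f g (l 0) (l 1)"
  proof (rule is_pullbackI[OF f g l'(1,2,4)])
    fix Z u v assume uv: "u \<in> Mor C Z A" "v \<in> Mor C Z D" "f \<cdot> u = g \<cdot> v"
    then have "is_cone J C D' E Z (\<lambda>a. if a = 0 then u else if a = 1 then v else f \<cdot> u)"
      by (simp add: cone)
    then obtain w where "w \<in> Mor C Z Q"
      "\<forall>a\<in>Ob J. l a \<cdot> w = (if a = 0 then u else if a = 1 then v else f \<cdot> u)"
      using l unfolding is_limit_def by blast
    then show "\<exists>w. w \<in> Mor C Z Q \<and> l 0 \<cdot> w = u \<and> l 1 \<cdot> w = v"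
      by (auto simp: J_def)
  next
    fix Z w w' assume w: "w \<in> Mor C Z Q" "w' \<in> Mor C Z Q"
      and eq: "l 0 \<cdot> w = l 0 \<cdot> w'" "l 1 \<cdot> w = l 1 \<cdot> w'"
    have l2: "l 2 \<cdot> v = f \<cdot> (l 0 \<cdot> v)" if "v \<in> Mor C Z Q" for v
      using Cmp_assoc[OF that l'(1) f] l'(3) by simp
    have "is_cone J C D' E Z (\<lambda>a. l a \<cdot> w)"
      unfolding cone using l' w Cmp_Mor Cmp_assoc[OF w(1) l'(1) f] Cmp_assoc[OF w(1) l'(2) g]
      by auto
    with l have "\<exists>!v. v \<in> Mor C Z Q \<and> (\<forall>a \<in> Ob J. l a \<cdot> v = l a \<cdot> w)"
      unfolding is_limit_def by blast
    moreover have "\<forall>a \<in> Ob J. l a \<cdot> w' = l a \<cdot> w"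
      using eq l2 w by (auto simp: J_def)
    ultimately show "w = w'" using w by blast
  qed
  then show ?thesis by (rule that)
qed

text \<open>Adding one factor to a finite product is a pullback over the terminal object.\<close>

lemma finite_products_from_pullbacks:
  assumes T: "is_terminal C T"
    and pb: "\<And>f g A D. \<lbrakk>f \<in> Mor C A T; g \<in> Mor C D T\<rbrakk> \<Longrightarrow> \<exists>h k. is_pullback C f g h k"
  shows "has_finite_products C"
  unfolding has_finite_products_def
proof (intro allI impI)
  fix I :: "nat set" and X
  assume "finite I" "\<forall>i\<in>I. X i \<in> Ob C"
  then show "\<exists>Q p. is_product C I X Q p"
  proof (induction I)
    case empty
    then show ?case using T by (auto simp: is_product_def is_terminal_def)
  next
    case (insert i I)
    then obtain Q p where Q: "is_product C I X Q p" by auto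
    have Ob: "Q \<in> Ob C" "X i \<in> Ob C" using Q insert.prems by (auto simp: is_product_def)
    then obtain f g where f: "f \<in> Mor C Q T" and g: "g \<in> Mor C (X i) T"
      using T unfolding is_terminal_def by blast
    obtain h k where hk: "is_pullback C f g h k" using pb[OF f g] by blast
    let ?R = "Src C h"
    have h: "h \<in> Mor C ?R Q" and k: "k \<in> Mor C ?R (X i)"
      using hk f g by (auto simp: is_pullback_def Mor_def)
    let ?p = "\<lambda>j. if j = i then k else p j \<cdot> h"
    have pj: "p j \<in> Mor C Q (X j)" if "j \<in> I" for j using Q that by (auto simp: is_product_def)
    have "\<exists>!w. w \<in> Mor C Z ?R \<and> (\<forall>j\<in>insert i I. ?p j \<cdot> w = u j)"
      if Z: "Z \<in> Ob C" and u: "\<forall>j\<in>insert i I. u j \<in> Mor C Z (X j)" for Z u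
    proof -
      have "\<exists>!q. q \<in> Mor C Z Q \<and> (\<forall>j\<in>I. p j \<cdot> q = u j)"
        using Q Z u by (simp add: is_product_def)
      then obtain q where q: "q \<in> Mor C Z Q" "\<forall>j\<in>I. p j \<cdot> q = u j"
        and q': "\<And>q'. \<lbrakk>q' \<in> Mor C Z Q; \<forall>j\<in>I. p j \<cdot> q' = u j\<rbrakk> \<Longrightarrow> q' = q"
        by metis
      have "f \<cdot> q = g \<cdot> u i"
        using T Z Cmp_Mor[OF q(1) f] Cmp_Mor[OF _ g, of "u i" Z] u
        unfolding is_terminal_def by blast
      then have ex1: "\<exists>!w. w \<in> Mor C Z ?R \<and> h \<cdot> w = q \<and> k \<cdot> w = u i"
        using pullback_lift[OF hk, of q Z "u i"] q u f g by (auto simp: Mor_def)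
      have same: "w \<in> Mor C Z ?R \<and> (\<forall>j\<in>insert i I. ?p j \<cdot> w = u j) \<longleftrightarrow>
        w \<in> Mor C Z ?R \<and> h \<cdot> w = q \<and> k \<cdot> w = u i" for w
      proof (cases "w \<in> Mor C Z ?R")
        case w: True
        have "(p j \<cdot> h) \<cdot> w = p j \<cdot> (h \<cdot> w)" if "j \<in> I" for j
          using Cmp_assoc[OF w h pj[OF that]] .
        then have "(\<forall>j\<in>insert i I. ?p j \<cdot> w = u j) \<longleftrightarrow> k \<cdot> w = u i \<and> (\<forall>j\<in>I. p j \<cdot> (h \<cdot> w) = u j)"
          using \<open>i \<notin> I\<close> by auto
        also have "\<dots> \<longleftrightarrow> k \<cdot> w = u i \<and> h \<cdot> w = q"
          using q q' Cmp_Mor[OF w h] by blast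
        finally show ?thesis by blast
      qed simp
      show ?thesis unfolding same by (rule ex1)
    qed
    moreover have "\<forall>j\<in>insert i I. ?p j \<in> Mor C ?R (X j)"
      using k Cmp_Mor[OF h pj] by auto
    ultimately have "is_product C (insert i I) X ?R ?p"
      using Mor_Ob(1)[OF h] by (simp add: is_product_def)
    then show ?case by blast
  qed
qed

end


section \<open>Stages and covers\<close>

locale frame_language = indexed_frame C P
  for C :: "('o, 'm, 'z) pcat_scheme" (structure) and P :: "('o, 'm, 'p) idx" +
  assumes chosen: "chosen_products C"
begin

abbreviation pred_le :: "'o \<Rightarrow> 'p \<Rightarrow> 'p \<Rightarrow> bool" where
  "pred_le K c d \<equiv> c \<sqsubseteq>\<^bsub>Fib P K\<^esub> d"

abbreviation Pred :: "'o \<Rightarrow> 'p set" where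
  "Pred K \<equiv> carrier (Fib P K)"

lemma weak_order: "K \<in> Ob C \<Longrightarrow> weak_partial_order (Fib P K)"
  using Fib_poset by (simp add: partial_order_def)

lemma pred_trans:
  assumes "K \<in> Ob C" "pred_le K a b" "pred_le K b c" "a \<in> Pred K" "b \<in> Pred K" "c \<in> Pred K"
  shows "pred_le K a c"
  using weak_partial_order.le_trans[OF weak_order[OF assms(1)] assms(2-6)] .

lemma pred_refl: "\<lbrakk>K \<in> Ob C; a \<in> Pred K\<rbrakk> \<Longrightarrow> pred_le K a a"
  using weak_partial_order.le_refl[OF weak_order] .

lemma weak_meets: "K \<in> Ob C \<Longrightarrow> weak_lower_semilattice (Fib P K)"
  using weak_order lower_semilattice.inf_of_two_exists[OF Fib_meets]
  by (simp add: weak_lower_semilattice_def weak_lower_semilattice_axioms_def)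

lemma meet_Pred: "\<lbrakk>K \<in> Ob C; a \<in> Pred K; b \<in> Pred K\<rbrakk> \<Longrightarrow> a \<sqinter>\<^bsub>Fib P K\<^esub> b \<in> Pred K"
  using weak_lower_semilattice.meet_closed[OF weak_meets] .

lemma le_meet_iff:
  assumes "K \<in> Ob C" "a \<in> Pred K" "b \<in> Pred K" "c \<in> Pred K"
  shows "pred_le K c (a \<sqinter>\<^bsub>Fib P K\<^esub> b) \<longleftrightarrow> pred_le K c a \<and> pred_le K c b"
proof -
  note m = weak_meets[OF assms(1)] and cl = meet_Pred[OF assms(1-3)]
  note left = weak_lower_semilattice.meet_left[OF m assms(2,3)]
    and right = weak_lower_semilattice.meet_right[OF m assms(2,3)]
  show ?thesis
    using pred_trans[OF assms(1) _ left assms(4) cl assms(2)]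
      pred_trans[OF assms(1) _ right assms(4) cl assms(3)]
      weak_lower_semilattice.meet_le[OF m _ _ assms(2-4)] by blast
qed

lemma top_Pred: "K \<in> Ob C \<Longrightarrow> \<top>\<^bsub>Fib P K\<^esub> \<in> Pred K"
  and le_top: "\<lbrakk>K \<in> Ob C; c \<in> Pred K\<rbrakk> \<Longrightarrow> pred_le K c \<top>\<^bsub>Fib P K\<^esub>"
proof -
  have "greatest (Fib P K) \<top>\<^bsub>Fib P K\<^esub> (Pred K)" if "K \<in> Ob C"
    using someI_ex[OF Fib_top[OF that]] by (simp add: top_def)
  then show "K \<in> Ob C \<Longrightarrow> \<top>\<^bsub>Fib P K\<^esub> \<in> Pred K"
    "\<lbrakk>K \<in> Ob C; c \<in> Pred K\<rbrakk> \<Longrightarrow> pred_le K c \<top>\<^bsub>Fib P K\<^esub>"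
    by (auto simp: greatest_def)
qed

lemma Reidx_le:
  assumes "f \<in> Mor C J I" "pred_le I a b" "a \<in> Pred I" "b \<in> Pred I"
  shows "pred_le J (Reidx P f a) (Reidx P f b)"
  using use_iso2[OF Reidx_mono[OF assms(1)] assms(3,4,2)] .

lemma Exq_galois:
  assumes "f \<in> Mor C J I"
  shows "galois_connection \<lparr>orderA = Fib P J, orderB = Fib P I,
    lower = Exq C P f, upper = Reidx P f\<rparr>"
proof -
  have "left_adjoint_at C P f (Exq C P f)"
    unfolding Exq_def using someI_ex[OF Ex[OF MorD(1)[OF assms]]] .
  then show ?thesis using assms by (simp add: left_adjoint_at_def Mor_def)
qed

lemma Exq_Pred: "\<lbrakk>f \<in> Mor C J I; a \<in> Pred J\<rbrakk> \<Longrightarrow> Exq C P f a \<in> Pred I"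
  using connection.lower_closed[OF galois_connection.axioms(1)[OF Exq_galois]] by simp

lemma Exq_adjoint:
  "\<lbrakk>f \<in> Mor C J I; a \<in> Pred J; b \<in> Pred I\<rbrakk> \<Longrightarrow>
    pred_le I (Exq C P f a) b \<longleftrightarrow> pred_le J a (Reidx P f b)"
  using galois_connection.galois_property[OF Exq_galois] by simp

text \<open>A stage is a pair \<open>(K, c)\<close> of an object and a predicate on it, thought of as the generic
  element of \<open>K\<close> satisfying \<open>c\<close>; a morphism \<open>h : K \<rightarrow> I\<close> is then an element of \<open>I\<close> at that stage.\<close>

definition stage :: "'o \<times> 'p \<Rightarrow> bool" where
  "stage S \<longleftrightarrow> fst S \<in> Ob C \<and> snd S \<in> Pred (fst S)"

abbreviation pt :: "'o \<times> 'p \<Rightarrow> 'o \<Rightarrow> 'm set" where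
  "pt S A \<equiv> Mor C (fst S) A"

definition refines :: "'m \<Rightarrow> 'o \<times> 'p \<Rightarrow> 'o \<times> 'p \<Rightarrow> bool" where
  "refines p R S \<longleftrightarrow> stage R \<and> stage S \<and> p \<in> pt R (fst S) \<and>
    pred_le (fst R) (snd R) (Reidx P p (snd S))"

definition covers :: "'m \<Rightarrow> 'o \<times> 'p \<Rightarrow> 'o \<times> 'p \<Rightarrow> bool" where
  "covers p R S \<longleftrightarrow> refines p R S \<and> pred_le (fst S) (snd S) (Exq C P p (snd R))"

definition holds :: "'o \<times> 'p \<Rightarrow> 'm \<Rightarrow> 'p \<Rightarrow> bool" where
  "holds S h \<phi> \<longleftrightarrow> pred_le (fst S) (snd S) (Reidx P h \<phi>)"

lemma covers_refines: "covers p R S \<Longrightarrow> refines p R S"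
  by (simp add: covers_def)

lemma refines_pt: "refines p R S \<Longrightarrow> p \<in> pt R (fst S)"
  and refines_stage: "refines p R S \<Longrightarrow> stage R" "refines p R S \<Longrightarrow> stage S"
  by (simp_all add: refines_def)

lemma holds_refine:
  assumes "refines p R S" "h \<in> pt S I" "\<phi> \<in> Pred I" "holds S h \<phi>"
  shows "holds R (h \<cdot> p) \<phi>"
proof -
  have p: "p \<in> pt R (fst S)" and c: "snd R \<in> Pred (fst R)" "snd S \<in> Pred (fst S)"
    and K: "fst R \<in> Ob C" and le: "pred_le (fst R) (snd R) (Reidx P p (snd S))"
    using assms(1) by (auto simp: refines_def stage_def)
  have "pred_le (fst R) (Reidx P p (snd S)) (Reidx P p (Reidx P h \<phi>))"
    using Reidx_le[OF p _ c(2) Reidx_closed[OF assms(2,3)]] assms(4) by (simp add: holds_def)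
  then show ?thesis
    unfolding holds_def Reidx_Cmp[OF p assms(2,3)]
    using pred_trans[OF K le _ c(1)] Reidx_closed[OF p c(2)]
      Reidx_closed[OF p Reidx_closed[OF assms(2,3)]] by simp
qed

text \<open>As \<open>\<exists>\<^sub>p\<close> is left adjoint to \<open>p\<^sup>*\<close>, what lies above \<open>c\<close> after reindexing to a cover of \<open>c\<close>
  already lies above \<open>c\<close>: forcing is local.\<close>

lemma holds_local:
  assumes "covers p R S" "h \<in> pt S I" "\<phi> \<in> Pred I" "holds R (h \<cdot> p) \<phi>"
  shows "holds S h \<phi>"
proof -
  have p: "p \<in> pt R (fst S)" and c: "snd R \<in> Pred (fst R)" "snd S \<in> Pred (fst S)"
    and K: "fst S \<in> Ob C" and le: "pred_le (fst S) (snd S) (Exq C P p (snd R))"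
    using assms(1) by (auto simp: covers_def refines_def stage_def)
  have "pred_le (fst R) (snd R) (Reidx P p (Reidx P h \<phi>))"
    using assms(4) unfolding holds_def Reidx_Cmp[OF p assms(2,3)] .
  then have "pred_le (fst S) (Exq C P p (snd R)) (Reidx P h \<phi>)"
    using Exq_adjoint[OF p c(1)] Reidx_closed[OF assms(2,3)] by simp
  then show ?thesis
    unfolding holds_def
    using pred_trans[OF K le] c(2) Exq_Pred[OF p c(1)] Reidx_closed[OF assms(2,3)] by blast
qed

lemma refines_id:
  assumes "stage S" shows "refines (Idn C (fst S)) S S"
  using assms Idn_Mor[of "fst S"] Reidx_Idn[of "fst S" "snd S"] pred_refl[of "fst S" "snd S"]
  by (simp add: refines_def stage_def)

lemma refines_trans:
  assumes "refines q R' R" "refines p R S" shows "refines (p \<cdot> q) R' S"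
proof -
  have p: "p \<in> pt R (fst S)" and q: "q \<in> pt R' (fst R)" and st: "stage R'" "stage S"
    and c: "snd S \<in> Pred (fst S)" and "holds R p (snd S)"
    using assms by (simp_all add: refines_def holds_def stage_def)
  then have "holds R' (p \<cdot> q) (snd S)" using holds_refine[OF assms(1) p c] by blast
  then show ?thesis
    using st Cmp_Mor[OF q p] by (simp add: refines_def holds_def)
qed

lemma covers_id:
  assumes "stage S" shows "covers (Idn C (fst S)) S S"
proof -
  have K: "fst S \<in> Ob C" "snd S \<in> Pred (fst S)" using assms by (auto simp: stage_def)
  note i = Idn_Mor[OF K(1)]
  have e: "Exq C P (Idn C (fst S)) (snd S) \<in> Pred (fst S)" by (rule Exq_Pred[OF i K(2)])
  have "pred_le (fst S) (snd S) (Reidx P (Idn C (fst S)) (Exq C P (Idn C (fst S)) (snd S)))"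
    using Exq_adjoint[OF i K(2) e] pred_refl[OF K(1) e] by simp
  then show ?thesis using refines_id[OF assms] Reidx_Idn[OF K(1) e] by (simp add: covers_def)
qed

lemma covers_trans:
  assumes "covers q R' R" "covers p R S" shows "covers (p \<cdot> q) R' S"
proof -
  note qr = covers_refines[OF assms(1)] and pr = covers_refines[OF assms(2)]
  have q: "q \<in> pt R' (fst R)" and p: "p \<in> pt R (fst S)"
    and c: "snd R' \<in> Pred (fst R')" "snd R \<in> Pred (fst R)" "snd S \<in> Pred (fst S)"
    and Ob: "fst S \<in> Ob C"
    using qr pr by (auto simp: refines_def stage_def)
  note pq = Cmp_Mor[OF q p]
  let ?e = "Exq C P (p \<cdot> q) (snd R')"
  have e: "?e \<in> Pred (fst S)" by (rule Exq_Pred[OF pq c(1)])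
  have "holds R' (p \<cdot> q) ?e"
    unfolding holds_def using Exq_adjoint[OF pq c(1) e] pred_refl[OF Ob e] by simp
  then have "holds R p ?e" using holds_local[OF assms(1) p e] by simp
  moreover have "Idn C (fst S) \<cdot> p = p" using Idn_Cmp[OF p] .
  ultimately have "holds S (Idn C (fst S)) ?e"
    using holds_local[OF assms(2) Idn_Mor[OF Ob] e] by simp
  then show ?thesis
    using refines_trans[OF qr pr] Reidx_Idn[OF Ob e] by (simp add: covers_def holds_def)
qed

lemma holds_Reidx:
  assumes "m \<in> Mor C I J" "h \<in> pt S I" "\<phi> \<in> Pred J"
  shows "holds S h (Reidx P m \<phi>) \<longleftrightarrow> holds S (m \<cdot> h) \<phi>"
  by (simp add: holds_def Reidx_Cmp[OF assms(2,1,3)])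

lemma holds_meet:
  assumes "stage S" "h \<in> pt S I" "\<phi> \<in> Pred I" "\<psi> \<in> Pred I"
  shows "holds S h (\<phi> \<sqinter>\<^bsub>Fib P I\<^esub> \<psi>) \<longleftrightarrow> holds S h \<phi> \<and> holds S h \<psi>"
  using assms(1) Reidx_closed[OF assms(2,3)] Reidx_closed[OF assms(2,4)]
  by (simp add: holds_def Reidx_meet[OF assms(2-4)] stage_def le_meet_iff)

lemma holds_top:
  assumes "stage S" "h \<in> pt S I"
  shows "holds S h \<top>\<^bsub>Fib P I\<^esub>"
  using assms(1) by (simp add: holds_def Reidx_top[OF assms(2)] stage_def le_top)

text \<open>The existential quantifier means existence after passing to a cover.  Given an element
  \<open>h\<close> of \<open>\<exists>\<^sub>g \<phi>\<close>, the witness lives on the pullback of \<open>g\<close> along \<open>h\<close>: the Beck-Chevalley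
  condition and Frobenius reciprocity make that pullback, cut down by \<open>\<phi>\<close>, a cover.\<close>

lemma holds_Exq:
  assumes S: "stage S" and g: "g \<in> Mor C B I" and h: "h \<in> pt S I" and \<phi>: "\<phi> \<in> Pred B"
  shows "holds S h (Exq C P g \<phi>) \<longleftrightarrow>
    (\<exists>R p k. covers p R S \<and> k \<in> pt R B \<and> g \<cdot> k = h \<cdot> p \<and> holds R k \<phi>)"
proof
  assume lhs: "holds S h (Exq C P g \<phi>)"
  obtain p k where pb: "is_pullback C h g p k"
    using finite_limits_pullback[OF finite_limits h g] .
  let ?K = "Src C p"
  have pk: "p \<in> Mor C ?K (fst S)" "k \<in> Mor C ?K B" "g \<cdot> k = h \<cdot> p"
    using pb h g by (auto simp: is_pullback_def Mor_def)
  have Ob: "?K \<in> Ob C" "fst S \<in> Ob C" using Mor_Ob pk by blast+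
  have s: "snd S \<in> Pred (fst S)" using S by (simp add: stage_def)
  let ?s = "Reidx P p (snd S)" and ?f = "Reidx P k \<phi>"
  have cl: "?s \<in> Pred ?K" "?f \<in> Pred ?K" using Reidx_closed pk s \<phi> by blast+
  let ?c = "?f \<sqinter>\<^bsub>Fib P ?K\<^esub> ?s"
  have c: "?c \<in> Pred ?K" using meet_Pred Ob cl by blast
  have c_le: "pred_le ?K ?c ?s" "pred_le ?K ?c ?f"
    using le_meet_iff[OF Ob(1) cl(2) cl(1) c] pred_refl[OF Ob(1) c] by simp_all
  have "pred_le (fst S) (snd S) (Reidx P h (Exq C P g \<phi>))" using lhs by (simp add: holds_def)
  also have "Reidx P h (Exq C P g \<phi>) = Exq C P p ?f" using BC[OF pb] g \<phi> by (simp add: Mor_def)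
  finally have "pred_le (fst S) (snd S) (Exq C P p ?f \<sqinter>\<^bsub>Fib P (fst S)\<^esub> snd S)"
    using le_meet_iff[OF Ob(2) Exq_Pred[OF pk(1) cl(2)] s s] pred_refl[OF Ob(2) s] by simp
  also have "Exq C P p ?f \<sqinter>\<^bsub>Fib P (fst S)\<^esub> snd S = Exq C P p ?c"
    using Fr[OF pk(1) cl(2) s] .
  finally have "covers p (?K, ?c) S"
    using S Ob c pk c_le by (simp add: covers_def refines_def stage_def)
  moreover have "holds (?K, ?c) k \<phi>" using c_le by (simp add: holds_def)
  ultimately show "\<exists>R p k. covers p R S \<and> k \<in> pt R B \<and> g \<cdot> k = h \<cdot> p \<and> holds R k \<phi>"
    using pk by (metis fst_conv)
next
  assume "\<exists>R p k. covers p R S \<and> k \<in> pt R B \<and> g \<cdot> k = h \<cdot> p \<and> holds R k \<phi>"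
  then obtain R p k where cov: "covers p R S" and k: "k \<in> pt R B"
    and gk: "g \<cdot> k = h \<cdot> p" and hold: "holds R k \<phi>" by blast
  let ?e = "Exq C P g \<phi>"
  have e: "?e \<in> Pred I" and I: "I \<in> Ob C" using Exq_Pred[OF g \<phi>] Mor_Ob(2)[OF g] by auto
  have R: "stage R" using cov by (simp add: covers_def refines_def)
  have "pred_le B \<phi> (Reidx P g ?e)"
    using Exq_adjoint[OF g \<phi> e] pred_refl[OF I e] by simp
  from Reidx_le[OF k this \<phi> Reidx_closed[OF g e]]
  have "pred_le (fst R) (Reidx P k \<phi>) (Reidx P k (Reidx P g ?e))" .
  with hold have "holds R k (Reidx P g ?e)"
    unfolding holds_def
    using pred_trans[of "fst R" "snd R"] R Reidx_closed[OF k \<phi>]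
      Reidx_closed[OF k Reidx_closed[OF g e]] by (simp add: stage_def)
  then have "holds R (h \<cdot> p) ?e" using holds_Reidx[OF g k e] gk by simp
  then show "holds S h ?e" using holds_local[OF cov h e] by simp
qed

end


section \<open>The internal language is interpreted by forcing\<close>

context frame_language
begin

subsection \<open>Tuples\<close>

abbreviation elems :: "'o \<Rightarrow> 'm list \<Rightarrow> 'o list \<Rightarrow> bool" where
  "elems X ms As \<equiv> list_all2 (\<lambda>m A. m \<in> Mor C X A) ms As"

lemma elems_Ob: "elems X ms As \<Longrightarrow> set As \<subseteq> Ob C"
  by (induction rule: list_all2_induct) (auto dest: Mor_Ob)

lemma elems_Tgt: "elems X ms As \<Longrightarrow> map (Tgt C) ms = As"
  by (induction rule: list_all2_induct) (auto simp: Mor_def)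

lemma elems_Cmp: "\<lbrakk>elems X ms As; p \<in> Mor C Y X\<rbrakk> \<Longrightarrow> elems Y (map (\<lambda>m. m \<cdot> p) ms) As"
  by (auto simp: list_all2_conv_all_nth intro: Cmp_Mor)

lemma product: "set As \<subseteq> Ob C \<Longrightarrow>
  is_product C {..<length As} ((!) As) (Prod C As) (Proj C As)"
  using chosen by (simp add: chosen_products_def)

lemma Prod_Ob: "set As \<subseteq> Ob C \<Longrightarrow> Prod C As \<in> Ob C"
  using product by (simp add: is_product_def)

lemma Proj_Mor: "\<lbrakk>set As \<subseteq> Ob C; i < length As\<rbrakk> \<Longrightarrow> Proj C As i \<in> Mor C (Prod C As) (As ! i)"
  using product by (simp add: is_product_def)

lemma Prod_single: "A \<in> Ob C \<Longrightarrow> Prod C [A] = A" "A \<in> Ob C \<Longrightarrow> Proj C [A] 0 = Idn C A"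
  using chosen by (simp_all add: chosen_products_def)

lemma tuple_ex1:
  assumes "X \<in> Ob C" "elems X ms As"
  shows "\<exists>!h. h \<in> Mor C X (Prod C As) \<and> (\<forall>i < length ms. Proj C As i \<cdot> h = ms ! i)"
proof -
  have "\<forall>i\<in>{..<length As}. ms ! i \<in> Mor C X (As ! i)" "length ms = length As"
    using assms(2) by (auto simp: list_all2_conv_all_nth)
  moreover have "\<forall>Z\<in>Ob C. \<forall>u. (\<forall>i\<in>{..<length As}. u i \<in> Mor C Z (As ! i)) \<longrightarrow>
      (\<exists>!h. h \<in> Mor C Z (Prod C As) \<and> (\<forall>i\<in>{..<length As}. Proj C As i \<cdot> h = u i))"
    using product[OF elems_Ob[OF assms(2)]] unfolding is_product_def by blast
  ultimately show ?thesis using assms(1) by (simp add: Ball_def)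
qed

lemma
  assumes "X \<in> Ob C" "elems X ms As"
  shows tuple_Mor: "tuple C X ms \<in> Mor C X (Prod C As)"
    and Proj_tuple: "i < length ms \<Longrightarrow> Proj C As i \<cdot> tuple C X ms = ms ! i"
  using theI'[OF tuple_ex1[OF assms]] elems_Tgt[OF assms(2)] by (simp_all add: tuple_def)

lemma tuple_eqI:
  assumes "h \<in> Mor C X (Prod C As)" "elems X ms As"
    and "\<And>i. i < length ms \<Longrightarrow> Proj C As i \<cdot> h = ms ! i"
  shows "tuple C X ms = h"
  using assms(1,3) tuple_ex1[OF Mor_Ob(1)[OF assms(1)] assms(2)]
    tuple_Mor[OF Mor_Ob(1)[OF assms(1)] assms(2)] Proj_tuple[OF Mor_Ob(1)[OF assms(1)] assms(2)]
  by blast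

lemma tuple_inject:
  assumes "X \<in> Ob C" "elems X ms As" "elems X ms' As"
  shows "tuple C X ms = tuple C X ms' \<longleftrightarrow> ms = ms'"
proof
  assume eq: "tuple C X ms = tuple C X ms'"
  have "length ms = length ms'" using assms(2,3) by (simp add: list_all2_conv_all_nth)
  then show "ms = ms'"
    using Proj_tuple[OF assms(1,2)] Proj_tuple[OF assms(1,3)] eq by (auto intro: nth_equalityI)
qed simp

lemma tuple_Cmp:
  assumes "elems X ms As" "p \<in> Mor C Y X"
  shows "tuple C X ms \<cdot> p = tuple C Y (map (\<lambda>m. m \<cdot> p) ms)"
proof (rule tuple_eqI[symmetric])
  note X = Mor_Ob(2)[OF assms(2)]
  note t = tuple_Mor[OF X assms(1)]
  show "tuple C X ms \<cdot> p \<in> Mor C Y (Prod C As)" using Cmp_Mor assms(2) t .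
  show "elems Y (map (\<lambda>m. m \<cdot> p) ms) As" using elems_Cmp assms .
  fix i assume i: "i < length (map (\<lambda>m. m \<cdot> p) ms)"
  then have "Proj C As i \<in> Mor C (Prod C As) (As ! i)"
    using Proj_Mor[OF elems_Ob[OF assms(1)]] list_all2_lengthD[OF assms(1)] by simp
  from Cmp_assoc[OF assms(2) t this]
  show "Proj C As i \<cdot> tuple C X ms \<cdot> p = map (\<lambda>m. m \<cdot> p) ms ! i"
    using Proj_tuple[OF X assms(1)] i by simp
qed

lemma elems_Proj:
  assumes "h \<in> Mor C X (Prod C As)" "set As \<subseteq> Ob C"
  shows "elems X (map (\<lambda>i. Proj C As i \<cdot> h) [0..<length As]) As"
  using Cmp_Mor[OF assms(1) Proj_Mor[OF assms(2)]] by (simp add: list_all2_conv_all_nth)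

lemma tuple_Proj:
  assumes "h \<in> Mor C X (Prod C As)" "set As \<subseteq> Ob C"
  shows "tuple C X (map (\<lambda>i. Proj C As i \<cdot> h) [0..<length As]) = h"
  by (rule tuple_eqI[OF assms(1) elems_Proj[OF assms]]) simp

lemma tuple_single: "x \<in> Mor C X A \<Longrightarrow> tuple C X [x] = x"
  using Mor_Ob(2) by (intro tuple_eqI[where As = "[A]"]) (auto simp: Prod_single Idn_Cmp)

lemma diag_Mor: "A \<in> Ob C \<Longrightarrow> diag C A \<in> Mor C A (Prod C [A, A])"
  unfolding diag_def by (rule tuple_Mor) (simp_all add: Idn_Mor)

lemma diag_Cmp:
  assumes "x \<in> Mor C X A" shows "diag C A \<cdot> x = tuple C X [x, x]"
proof -
  have "elems A [Idn C A, Idn C A] [A, A]" using Mor_Ob(2)[OF assms] by (simp add: Idn_Mor)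
  from tuple_Cmp[OF this assms] show ?thesis using assms by (simp add: diag_def Idn_Cmp)
qed

lemma
  assumes "set \<Gamma> \<subseteq> Ob C" "A \<in> Ob C"
  shows ctx_proj_Mor: "ctx_proj C \<Gamma> A \<in> Mor C (Prod C (\<Gamma> @ [A])) (Prod C \<Gamma>)"
    and ctx_proj_tuple: "\<lbrakk>elems X xs \<Gamma>; y \<in> Mor C X A\<rbrakk> \<Longrightarrow>
      ctx_proj C \<Gamma> A \<cdot> tuple C X (xs @ [y]) = tuple C X xs"
proof -
  have Ob: "set (\<Gamma> @ [A]) \<subseteq> Ob C" using assms by simp
  let ?ps = "map (Proj C (\<Gamma> @ [A])) [0..<length \<Gamma>]"
  have ps: "elems (Prod C (\<Gamma> @ [A])) ?ps \<Gamma>"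
    unfolding list_all2_conv_all_nth
  proof (intro conjI allI impI)
    fix i assume "i < length ?ps"
    then show "?ps ! i \<in> Mor C (Prod C (\<Gamma> @ [A])) (\<Gamma> ! i)"
      using Proj_Mor[OF Ob, of i] by (simp add: nth_append)
  qed simp
  show "ctx_proj C \<Gamma> A \<in> Mor C (Prod C (\<Gamma> @ [A])) (Prod C \<Gamma>)"
    unfolding ctx_proj_def using tuple_Mor[OF Prod_Ob[OF Ob] ps] .
  assume xs: "elems X xs \<Gamma>" and y: "y \<in> Mor C X A"
  have xsy: "elems X (xs @ [y]) (\<Gamma> @ [A])" using xs y by (simp add: list_all2_appendI)
  note X = Mor_Ob(1)[OF y]
  have "map (\<lambda>m. m \<cdot> tuple C X (xs @ [y])) ?ps = xs"
    using Proj_tuple[OF X xsy] list_all2_lengthD[OF xs]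
    by (auto intro!: nth_equalityI simp: nth_append)
  then show "ctx_proj C \<Gamma> A \<cdot> tuple C X (xs @ [y]) = tuple C X xs"
    unfolding ctx_proj_def using tuple_Cmp[OF ps tuple_Mor[OF X xsy]] by simp
qed

subsection \<open>Forcing\<close>

text \<open>The clauses of \<open>forces\<close> are the Kripke-Joyal clauses for regular logic.  Equality is
  \<open>\<exists>\<^sub>\<delta> \<top>\<close>, hence an existential statement as well, and so its clause mentions a cover.\<close>

fun tm_val :: "'o \<Rightarrow> 'm list \<Rightarrow> 'm tm \<Rightarrow> 'm" where
  "tm_val K xs (Var i) = xs ! i"
| "tm_val K xs (Fn f ts) = f \<cdot> tuple C K (map (tm_val K xs) ts)"

fun forces :: "'o \<times> 'p \<Rightarrow> 'm list \<Rightarrow> ('o, 'm, 'p) fm \<Rightarrow> bool" where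
  "forces S xs (Rel r ts) \<longleftrightarrow> holds S (tuple C (fst S) (map (tm_val (fst S) xs) ts)) r"
| "forces S xs (Equ t u) \<longleftrightarrow>
    (\<exists>R p. covers p R S \<and> tm_val (fst S) xs t \<cdot> p = tm_val (fst S) xs u \<cdot> p)"
| "forces S xs Top \<longleftrightarrow> True"
| "forces S xs (And \<phi> \<psi>) \<longleftrightarrow> forces S xs \<phi> \<and> forces S xs \<psi>"
| "forces S xs (Exi A \<phi>) \<longleftrightarrow>
    (\<exists>R p y. covers p R S \<and> y \<in> pt R A \<and> forces R (map (\<lambda>x. x \<cdot> p) xs @ [y]) \<phi>)"

inductive tm_sort :: "'o list \<Rightarrow> 'm tm \<Rightarrow> 'o \<Rightarrow> bool" for \<Gamma> where
  Var: "i < length \<Gamma> \<Longrightarrow> tm_sort \<Gamma> (Var i) (\<Gamma> ! i)"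
| Fn: "\<lbrakk>list_all2 (tm_sort \<Gamma>) ts As; f \<in> Mor C (Prod C As) B\<rbrakk> \<Longrightarrow> tm_sort \<Gamma> (Fn f ts) B"

fun fm_wf :: "'o list \<Rightarrow> ('o, 'm, 'p) fm \<Rightarrow> bool" where
  "fm_wf \<Gamma> (Rel r ts) \<longleftrightarrow> (\<exists>As. list_all2 (tm_sort \<Gamma>) ts As \<and> r \<in> Pred (Prod C As))"
| "fm_wf \<Gamma> (Equ t u) \<longleftrightarrow> (\<exists>A. tm_sort \<Gamma> t A \<and> tm_sort \<Gamma> u A)"
| "fm_wf \<Gamma> Top \<longleftrightarrow> True"
| "fm_wf \<Gamma> (And \<phi> \<psi>) \<longleftrightarrow> fm_wf \<Gamma> \<phi> \<and> fm_wf \<Gamma> \<psi>"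
| "fm_wf \<Gamma> (Exi A \<phi>) \<longleftrightarrow> A \<in> Ob C \<and> fm_wf (\<Gamma> @ [A]) \<phi>"

lemma tm_int_Mor:
  assumes "set \<Gamma> \<subseteq> Ob C" "tm_sort \<Gamma> t A"
  shows "tm_int C \<Gamma> t \<in> Mor C (Prod C \<Gamma>) A"
  using assms(2)
proof induction
  case (Var i)
  then show ?case using Proj_Mor[OF assms(1)] by simp
next
  case (Fn ts As f B)
  then have "elems (Prod C \<Gamma>) (map (tm_int C \<Gamma>) ts) As"
    by (simp add: list_all2_conv_all_nth)
  from Cmp_Mor[OF tuple_Mor[OF Prod_Ob[OF assms(1)] this] Fn(2)] show ?case by simp
qed

lemma elems_tm_int:
  assumes "set \<Gamma> \<subseteq> Ob C" "list_all2 (tm_sort \<Gamma>) ts As"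
  shows "elems (Prod C \<Gamma>) (map (tm_int C \<Gamma>) ts) As"
  using assms(2) tm_int_Mor[OF assms(1)] by (simp add: list_all2_conv_all_nth)

lemma tm_int_tuple:
  assumes xs: "elems X xs \<Gamma>" "X \<in> Ob C" and t: "tm_sort \<Gamma> t A"
  shows "tm_int C \<Gamma> t \<cdot> tuple C X xs = tm_val X xs t"
  using t
proof induction
  case (Var i)
  then show ?case using Proj_tuple[OF xs(2,1)] list_all2_lengthD[OF xs(1)] by simp
next
  case (Fn ts As f B)
  then have sorts: "list_all2 (tm_sort \<Gamma>) ts As"
    and eqs: "\<And>t. t \<in> set ts \<Longrightarrow> tm_int C \<Gamma> t \<cdot> tuple C X xs = tm_val X xs t"
    by (auto simp: list_all2_conv_all_nth in_set_conv_nth)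
  note \<Gamma> = elems_Ob[OF xs(1)]
  note el = elems_tm_int[OF \<Gamma> sorts] and h = tuple_Mor[OF xs(2,1)]
  have "tuple C (Prod C \<Gamma>) (map (tm_int C \<Gamma>) ts) \<cdot> tuple C X xs = tuple C X (map (tm_val X xs) ts)"
    using tuple_Cmp[OF el h] eqs by (simp cong: map_cong)
  then show ?case
    using Cmp_assoc[OF h tuple_Mor[OF Prod_Ob[OF \<Gamma>] el] Fn(2)] by simp
qed

lemma tm_val_Mor:
  assumes "elems X xs \<Gamma>" "X \<in> Ob C" "tm_sort \<Gamma> t A"
  shows "tm_val X xs t \<in> Mor C X A"
  using tm_int_tuple[OF assms] Cmp_Mor[OF tuple_Mor[OF assms(2,1)]
    tm_int_Mor[OF elems_Ob[OF assms(1)] assms(3)]] by simp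

lemma Equ_Pred: "A \<in> Ob C \<Longrightarrow> Exq C P (diag C A) \<top>\<^bsub>Fib P A\<^esub> \<in> Pred (Prod C [A, A])"
  using Exq_Pred[OF diag_Mor] top_Pred by blast

lemma fm_int_Pred:
  assumes "set \<Gamma> \<subseteq> Ob C" "fm_wf \<Gamma> \<phi>"
  shows "fm_int C P \<Gamma> \<phi> \<in> Pred (Prod C \<Gamma>)"
  using assms
proof (induction \<phi> arbitrary: \<Gamma>)
  case (Rel r ts)
  then obtain As where As: "list_all2 (tm_sort \<Gamma>) ts As" "r \<in> Pred (Prod C As)" by auto
  note t = tuple_Mor[OF Prod_Ob[OF Rel(1)] elems_tm_int[OF Rel(1) As(1)]]
  show ?case using Reidx_closed[OF t As(2)] by simp
next
  case (Equ t u)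
  then obtain A where "tm_sort \<Gamma> t A" "tm_sort \<Gamma> u A" by auto
  then have tu: "tm_int C \<Gamma> t \<in> Mor C (Prod C \<Gamma>) A" "tm_int C \<Gamma> u \<in> Mor C (Prod C \<Gamma>) A"
    using tm_int_Mor[OF Equ(1)] by blast+
  have "elems (Prod C \<Gamma>) [tm_int C \<Gamma> t, tm_int C \<Gamma> u] [A, A]" using tu by simp
  from Reidx_closed[OF tuple_Mor[OF Prod_Ob[OF Equ(1)] this] Equ_Pred[OF Mor_Ob(2)[OF tu(1)]]]
  show ?case using MorD(3)[OF tu(1)] by (simp add: Let_def)
next
  case Top
  then show ?case using top_Pred Prod_Ob by simp
next
  case (And \<phi> \<psi>)
  then show ?case using meet_Pred[OF Prod_Ob] by simp
next
  case (Exi A \<phi>)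
  then have "set (\<Gamma> @ [A]) \<subseteq> Ob C" "fm_wf (\<Gamma> @ [A]) \<phi>" "A \<in> Ob C" by simp_all
  then show ?case using Exq_Pred[OF ctx_proj_Mor[OF Exi(2)]] Exi.IH by simp
qed

text \<open>By induction on the formula; the clauses for \<open>Equ\<close> and \<open>Exi\<close> are instances of \<open>holds_Exq\<close>
  for the diagonal and for the projection that forgets the last variable.\<close>

theorem forces_iff_holds:
  assumes "fm_wf \<Gamma> \<phi>" "stage S" "elems (fst S) xs \<Gamma>"
  shows "forces S xs \<phi> \<longleftrightarrow> holds S (tuple C (fst S) xs) (fm_int C P \<Gamma> \<phi>)"
  using assms
proof (induction \<phi> arbitrary: \<Gamma> S xs)
  case (Rel r ts)
  then obtain As where As: "list_all2 (tm_sort \<Gamma>) ts As" "r \<in> Pred (Prod C As)" by auto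
  have S: "fst S \<in> Ob C" using Rel(2) by (simp add: stage_def)
  note \<Gamma> = elems_Ob[OF Rel(3)] and h = tuple_Mor[OF S Rel(3)]
  note el = elems_tm_int[OF \<Gamma> As(1)]
  have "map (\<lambda>t. tm_int C \<Gamma> t \<cdot> tuple C (fst S) xs) ts = map (tm_val (fst S) xs) ts"
  proof (rule map_cong[OF refl])
    fix t assume "t \<in> set ts"
    with As(1) obtain B where "tm_sort \<Gamma> t B" by (auto simp: list_all2_conv_all_nth in_set_conv_nth)
    then show "tm_int C \<Gamma> t \<cdot> tuple C (fst S) xs = tm_val (fst S) xs t" by (rule tm_int_tuple[OF Rel(3) S])
  qed
  then show ?case
    using holds_Reidx[OF tuple_Mor[OF Prod_Ob[OF \<Gamma>] el] h As(2)] tuple_Cmp[OF el h]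
    by (simp add: comp_def cong: map_cong)
next
  case (Equ t u)
  then obtain A where A: "tm_sort \<Gamma> t A" "tm_sort \<Gamma> u A" by auto
  have S: "fst S \<in> Ob C" using Equ(2) by (simp add: stage_def)
  note \<Gamma> = elems_Ob[OF Equ(3)] and h = tuple_Mor[OF S Equ(3)]
  let ?t = "tm_val (fst S) xs t" and ?u = "tm_val (fst S) xs u"
  note ti = tm_int_Mor[OF \<Gamma> A(1)] and ui = tm_int_Mor[OF \<Gamma> A(2)]
  note t = tm_val_Mor[OF Equ(3) S A(1)] and u = tm_val_Mor[OF Equ(3) S A(2)]
  note Ob = Mor_Ob(2)[OF t]
  have tui: "elems (Prod C \<Gamma>) [tm_int C \<Gamma> t, tm_int C \<Gamma> u] [A, A]" using ti ui by simp
  have tu: "elems (fst S) [?t, ?u] [A, A]" using t u by simp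
  let ?h = "tuple C (fst S) [?t, ?u]"
  have "holds S (tuple C (fst S) xs) (fm_int C P \<Gamma> (Equ t u)) \<longleftrightarrow>
    holds S (tuple C (Prod C \<Gamma>) [tm_int C \<Gamma> t, tm_int C \<Gamma> u] \<cdot> tuple C (fst S) xs)
      (Exq C P (diag C A) \<top>\<^bsub>Fib P A\<^esub>)"
    using holds_Reidx[OF tuple_Mor[OF Prod_Ob[OF \<Gamma>] tui] h Equ_Pred[OF Ob]] MorD(3)[OF ti]
    by (simp add: Let_def)
  also have "tuple C (Prod C \<Gamma>) [tm_int C \<Gamma> t, tm_int C \<Gamma> u] \<cdot> tuple C (fst S) xs = ?h"
    using tuple_Cmp[OF tui h] tm_int_tuple[OF Equ(3) S] A by simp
  also have "holds S ?h (Exq C P (diag C A) \<top>\<^bsub>Fib P A\<^esub>) \<longleftrightarrow> (\<exists>R p k. covers p R S \<and>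
      k \<in> pt R A \<and> diag C A \<cdot> k = ?h \<cdot> p \<and> holds R k \<top>\<^bsub>Fib P A\<^esub>)"
    by (rule holds_Exq[OF Equ(2) diag_Mor[OF Ob] tuple_Mor[OF S tu] top_Pred[OF Ob]])
  also have "\<dots> \<longleftrightarrow> (\<exists>R p. covers p R S \<and> ?t \<cdot> p = ?u \<cdot> p)"
  proof -
    have "(\<exists>k. k \<in> pt R A \<and> diag C A \<cdot> k = ?h \<cdot> p \<and> holds R k \<top>\<^bsub>Fib P A\<^esub>) \<longleftrightarrow> ?t \<cdot> p = ?u \<cdot> p"
      if cov: "covers p R S" for R p
    proof -
      have p: "p \<in> pt R (fst S)" and R: "stage R"
        using refines_pt refines_stage covers_refines[OF cov] by blast+
      have RO: "fst R \<in> Ob C" using R by (simp add: stage_def)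
      have hp: "?h \<cdot> p = tuple C (fst R) [?t \<cdot> p, ?u \<cdot> p]" using tuple_Cmp[OF tu p] by simp
      note tp = Cmp_Mor[OF p t] and up = Cmp_Mor[OF p u]
      have "diag C A \<cdot> k = ?h \<cdot> p \<longleftrightarrow> k = ?t \<cdot> p \<and> k = ?u \<cdot> p" if "k \<in> pt R A" for k
        unfolding hp diag_Cmp[OF that]
        using tuple_inject[OF RO, of "[k, k]" "[A, A]" "[?t \<cdot> p, ?u \<cdot> p]"] that tp up by simp
      then show ?thesis using tp holds_top[OF R] by metis
    qed
    then show ?thesis by blast
  qed
  finally show ?case by simp
next
  case Top
  then have "fst S \<in> Ob C" by (simp add: stage_def)
  from holds_top[OF Top(2) tuple_Mor[OF this Top(3)]] show ?case by simp
next
  case (And \<phi> \<psi>)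
  have S: "fst S \<in> Ob C" using And.prems(2) by (simp add: stage_def)
  note \<Gamma> = elems_Ob[OF And.prems(3)] and h = tuple_Mor[OF S And.prems(3)]
  have wf: "fm_wf \<Gamma> \<phi>" "fm_wf \<Gamma> \<psi>" using And.prems(1) by simp_all
  show ?case
    using holds_meet[OF And.prems(2) h fm_int_Pred[OF \<Gamma> wf(1)] fm_int_Pred[OF \<Gamma> wf(2)]]
      And.IH(1)[OF wf(1) And.prems(2,3)] And.IH(2)[OF wf(2) And.prems(2,3)] by simp
next
  case (Exi A \<phi>)
  have wf: "fm_wf (\<Gamma> @ [A]) \<phi>" and A: "A \<in> Ob C" using Exi.prems(1) by simp_all
  have S: "fst S \<in> Ob C" using Exi.prems(2) by (simp add: stage_def)
  note xs = Exi.prems(3)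
  note \<Gamma> = elems_Ob[OF xs] and h = tuple_Mor[OF S xs]
  have \<Gamma>A: "set (\<Gamma> @ [A]) \<subseteq> Ob C" using \<Gamma> A by simp
  let ?h = "tuple C (fst S) xs" and ?\<phi> = "fm_int C P (\<Gamma> @ [A]) \<phi>"
  have "holds S ?h (fm_int C P \<Gamma> (Exi A \<phi>)) \<longleftrightarrow> (\<exists>R p k. covers p R S \<and>
      k \<in> pt R (Prod C (\<Gamma> @ [A])) \<and> ctx_proj C \<Gamma> A \<cdot> k = ?h \<cdot> p \<and> holds R k ?\<phi>)"
    using holds_Exq[OF Exi.prems(2) ctx_proj_Mor[OF \<Gamma> A] h fm_int_Pred[OF \<Gamma>A wf]] by simp
  also have "\<dots> \<longleftrightarrow>
    (\<exists>R p y. covers p R S \<and> y \<in> pt R A \<and> forces R (map (\<lambda>x. x \<cdot> p) xs @ [y]) \<phi>)"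
  proof -
    have "(\<exists>k. k \<in> pt R (Prod C (\<Gamma> @ [A])) \<and> ctx_proj C \<Gamma> A \<cdot> k = ?h \<cdot> p \<and> holds R k ?\<phi>) \<longleftrightarrow>
        (\<exists>y. y \<in> pt R A \<and> forces R (map (\<lambda>x. x \<cdot> p) xs @ [y]) \<phi>)" (is "?lhs \<longleftrightarrow> ?rhs")
      if cov: "covers p R S" for R p
    proof -
      have p: "p \<in> pt R (fst S)" and R: "stage R"
        using refines_pt refines_stage covers_refines[OF cov] by blast+
      have RO: "fst R \<in> Ob C" using R by (simp add: stage_def)
      let ?xp = "map (\<lambda>x. x \<cdot> p) xs"
      have xp: "elems (fst R) ?xp \<Gamma>" using elems_Cmp[OF xs p] .
      have hp: "?h \<cdot> p = tuple C (fst R) ?xp" using tuple_Cmp[OF xs p] .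
      have env: "elems (fst R) (zs @ [y]) (\<Gamma> @ [A])"
        if "elems (fst R) zs \<Gamma>" "y \<in> pt R A" for zs y
        using that by (simp add: list_all2_appendI)
      show ?thesis
      proof
        assume ?lhs
        then obtain k where k: "k \<in> pt R (Prod C (\<Gamma> @ [A]))" "ctx_proj C \<Gamma> A \<cdot> k = ?h \<cdot> p"
          "holds R k ?\<phi>" by blast
        let ?ks = "map (\<lambda>i. Proj C (\<Gamma> @ [A]) i \<cdot> k) [0..<length (\<Gamma> @ [A])]"
        have "elems (fst R) ?ks (\<Gamma> @ [A])" by (rule elems_Proj[OF k(1) \<Gamma>A])
        then obtain zs y where zs: "elems (fst R) zs \<Gamma>" and y: "y \<in> pt R A" and ks: "?ks = zs @ [y]"
          unfolding list_all2_append2 by (auto simp: list_all2_Cons2)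
        have kt: "k = tuple C (fst R) (zs @ [y])" using tuple_Proj[OF k(1) \<Gamma>A] ks by simp
        have "zs = ?xp"
          using k(2) hp kt ctx_proj_tuple[OF \<Gamma> A zs y] tuple_inject[OF RO zs xp] by simp
        then show ?rhs using Exi.IH[OF wf R env[OF xp y]] k(3) kt y by blast
      next
        assume ?rhs
        then obtain y where y: "y \<in> pt R A" "forces R (?xp @ [y]) \<phi>" by blast
        show ?lhs
          using Exi.IH[OF wf R env[OF xp y(1)]] y(2) tuple_Mor[OF RO env[OF xp y(1)]]
            ctx_proj_tuple[OF \<Gamma> A xp y(1)] hp by metis
      qed
    qed
    then show ?thesis by blast
  qed
  finally show ?case by simp
qed

lemma forces_foldr_And: "forces S xs (foldr And \<phi>s Top) \<longleftrightarrow> (\<forall>\<phi>\<in>set \<phi>s. forces S xs \<phi>)"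
  by (induction \<phi>s) auto

lemma fm_wf_foldr_And: "fm_wf \<Gamma> (foldr And \<phi>s Top) \<longleftrightarrow> (\<forall>\<phi>\<in>set \<phi>s. fm_wf \<Gamma> \<phi>)"
  by (induction \<phi>s) auto

text \<open>Soundness and completeness of forcing: for completeness take the generic stage, whose
  object is the context itself and whose elements are the projections.\<close>

theorem entails_iff_forces:
  assumes \<Gamma>: "set \<Gamma> \<subseteq> Ob C" and wf: "\<And>\<phi>. \<phi> \<in> set \<phi>s \<Longrightarrow> fm_wf \<Gamma> \<phi>" "fm_wf \<Gamma> \<psi>"
  shows "entails C P \<Gamma> \<phi>s \<psi> \<longleftrightarrow>
    (\<forall>S xs. stage S \<longrightarrow> elems (fst S) xs \<Gamma> \<longrightarrow> (\<forall>\<phi>\<in>set \<phi>s. forces S xs \<phi>) \<longrightarrow> forces S xs \<psi>)"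
proof -
  let ?\<phi> = "foldr And \<phi>s Top" and ?K = "Prod C \<Gamma>"
  have wf': "fm_wf \<Gamma> ?\<phi>" using wf(1) by (simp add: fm_wf_foldr_And)
  let ?c = "fm_int C P \<Gamma> ?\<phi>" and ?d = "fm_int C P \<Gamma> \<psi>"
  note cd = fm_int_Pred[OF \<Gamma> wf'] fm_int_Pred[OF \<Gamma> wf(2)] and K = Prod_Ob[OF \<Gamma>]
  show ?thesis
  proof (intro iffI allI impI)
    fix S xs
    assume le: "entails C P \<Gamma> \<phi>s \<psi>" and S: "stage S" and xs: "elems (fst S) xs \<Gamma>"
      and hyp: "\<forall>\<phi>\<in>set \<phi>s. forces S xs \<phi>"
    have SO: "fst S \<in> Ob C" "snd S \<in> Pred (fst S)" using S by (simp_all add: stage_def)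
    note h = tuple_Mor[OF SO(1) xs]
    have "forces S xs ?\<phi>" using hyp by (simp add: forces_foldr_And)
    then have "pred_le (fst S) (snd S) (Reidx P (tuple C (fst S) xs) ?c)"
      using forces_iff_holds[OF wf' S xs] by (simp add: holds_def)
    moreover have "pred_le (fst S) (Reidx P (tuple C (fst S) xs) ?c) (Reidx P (tuple C (fst S) xs) ?d)"
      using Reidx_le[OF h _ cd] le by (simp add: entails_def)
    ultimately have "holds S (tuple C (fst S) xs) ?d"
      unfolding holds_def
      using pred_trans[OF SO(1) _ _ SO(2) Reidx_closed[OF h cd(1)] Reidx_closed[OF h cd(2)]] by blast
    then show "forces S xs \<psi>" using forces_iff_holds[OF wf(2) S xs] by simp
  next
    assume all: "\<forall>S xs. stage S \<longrightarrow> elems (fst S) xs \<Gamma> \<longrightarrow>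
      (\<forall>\<phi>\<in>set \<phi>s. forces S xs \<phi>) \<longrightarrow> forces S xs \<psi>"
    let ?S = "(?K, ?c)" and ?xs = "map (\<lambda>i. Proj C \<Gamma> i \<cdot> Idn C ?K) [0..<length \<Gamma>]"
    have S: "stage ?S" using K cd by (simp add: stage_def)
    have xs: "elems (fst ?S) ?xs \<Gamma>" using elems_Proj[OF Idn_Mor[OF K] \<Gamma>] by simp
    have gen: "tuple C (fst ?S) ?xs = Idn C ?K" using tuple_Proj[OF Idn_Mor[OF K] \<Gamma>] by simp
    have "holds ?S (Idn C ?K) ?c"
      using pred_refl[OF K cd(1)] by (simp add: holds_def Reidx_Idn[OF K cd(1)])
    then have "forces ?S ?xs ?\<phi>" using forces_iff_holds[OF wf' S xs] gen by simp
    then have "forces ?S ?xs \<psi>" using all S xs by (simp add: forces_foldr_And)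
    then have "holds ?S (Idn C ?K) ?d" using forces_iff_holds[OF wf(2) S xs] gen by simp
    then show "entails C P \<Gamma> \<phi>s \<psi>"
      by (simp add: entails_def holds_def Reidx_Idn[OF K cd(2)])
  qed
qed

end


section \<open>Partial equivalence relations elementwise\<close>

context frame_language
begin

text \<open>Typing information is made part of \<open>eqv\<close>, so that it never has to be carried along
  separately.\<close>

definition eqv :: "'o \<times> 'p \<Rightarrow> 'o \<times> 'p \<Rightarrow> 'm \<Rightarrow> 'm \<Rightarrow> bool" where
  "eqv X S x y \<longleftrightarrow> stage S \<and> x \<in> pt S (fst X) \<and> y \<in> pt S (fst X) \<and>
    holds S (tuple C (fst S) [x, y]) (snd X)"

definition rel_obj :: "'o \<times> 'p \<Rightarrow> bool" where
  "rel_obj X \<longleftrightarrow> fst X \<in> Ob C \<and> snd X \<in> Pred (Prod C [fst X, fst X])"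

lemma eqv_stage: "eqv X S x y \<Longrightarrow> stage S"
  and eqv_pt: "eqv X S x y \<Longrightarrow> x \<in> pt S (fst X)" "eqv X S x y \<Longrightarrow> y \<in> pt S (fst X)"
  by (simp_all add: eqv_def)

lemma pair_Mor:
  assumes "x \<in> Mor C K A" "y \<in> Mor C K B"
  shows "tuple C K [x, y] \<in> Mor C K (Prod C [A, B])"
    and "p \<in> Mor C L K \<Longrightarrow> tuple C K [x, y] \<cdot> p = tuple C L [x \<cdot> p, y \<cdot> p]"
  using tuple_Mor[OF Mor_Ob(1)[OF assms(1)], of "[x, y]" "[A, B]"]
    tuple_Cmp[of K "[x, y]" "[A, B]"] assms by simp_all

lemma eqv_refine:
  assumes "rel_obj X" "refines p R S" "eqv X S x y"
  shows "eqv X R (x \<cdot> p) (y \<cdot> p)"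
proof -
  note p = refines_pt[OF assms(2)] and xy = eqv_pt[OF assms(3)]
  show ?thesis
    using holds_refine[OF assms(2) pair_Mor(1)[OF xy], of "snd X"] assms(1,3)
      refines_stage(1)[OF assms(2)] pair_Mor(2)[OF xy p] Cmp_Mor[OF p xy(1)] Cmp_Mor[OF p xy(2)]
    by (simp add: eqv_def rel_obj_def)
qed

lemma eqv_local:
  assumes "rel_obj X" "covers p R S" "x \<in> pt S (fst X)" "y \<in> pt S (fst X)"
    and "eqv X R (x \<cdot> p) (y \<cdot> p)"
  shows "eqv X S x y"
proof -
  note ref = covers_refines[OF assms(2)]
  note p = refines_pt[OF ref]
  show ?thesis
    using holds_local[OF assms(2) pair_Mor(1)[OF assms(3,4)], of "snd X"] assms
      refines_stage(2)[OF ref] pair_Mor(2)[OF assms(3,4) p]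
    by (simp add: eqv_def rel_obj_def)
qed

lemma tm_sort_Var [simp]: "tm_sort \<Gamma> (Var i) A \<longleftrightarrow> i < length \<Gamma> \<and> A = \<Gamma> ! i"
  by (auto elim: tm_sort.cases intro: tm_sort.intros)

lemma tm_sort_app: "\<lbrakk>f \<in> Mor C A B; tm_sort \<Gamma> t A\<rbrakk> \<Longrightarrow> tm_sort \<Gamma> (Fn f [t]) B"
  using Mor_Ob(1) by (intro tm_sort.Fn[where As = "[A]"]) (simp_all add: Prod_single)

lemma fm_wf_Rel2:
  "\<lbrakk>r \<in> Pred (Prod C [A, B]); tm_sort \<Gamma> t A; tm_sort \<Gamma> u B\<rbrakk> \<Longrightarrow> fm_wf \<Gamma> (Rel r [t, u])"
  by (auto intro!: exI[of _ "[A, B]"])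

lemma fm_wf_Equ: "\<lbrakk>tm_sort \<Gamma> t A; tm_sort \<Gamma> u A\<rbrakk> \<Longrightarrow> fm_wf \<Gamma> (Equ t u)"
  by auto

lemma entails_ctx1:
  assumes "A \<in> Ob C" "\<And>\<phi>. \<phi> \<in> set \<phi>s \<Longrightarrow> fm_wf [A] \<phi>" "fm_wf [A] \<psi>"
  shows "entails C P [A] \<phi>s \<psi> \<longleftrightarrow> (\<forall>S. stage S \<longrightarrow> (\<forall>x\<in>pt S A.
    (\<forall>\<phi>\<in>set \<phi>s. forces S [x] \<phi>) \<longrightarrow> forces S [x] \<psi>))"
  using assms by (subst entails_iff_forces) (auto simp: list_all2_Cons2)

lemma entails_ctx2:
  assumes "A \<in> Ob C" "B \<in> Ob C" "\<And>\<phi>. \<phi> \<in> set \<phi>s \<Longrightarrow> fm_wf [A, B] \<phi>" "fm_wf [A, B] \<psi>"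
  shows "entails C P [A, B] \<phi>s \<psi> \<longleftrightarrow> (\<forall>S. stage S \<longrightarrow> (\<forall>x\<in>pt S A. \<forall>y\<in>pt S B.
    (\<forall>\<phi>\<in>set \<phi>s. forces S [x, y] \<phi>) \<longrightarrow> forces S [x, y] \<psi>))"
  using assms by (subst entails_iff_forces) (auto simp: list_all2_Cons2)

lemma entails_ctx3:
  assumes "A \<in> Ob C" "B \<in> Ob C" "D \<in> Ob C"
    and "\<And>\<phi>. \<phi> \<in> set \<phi>s \<Longrightarrow> fm_wf [A, B, D] \<phi>" "fm_wf [A, B, D] \<psi>"
  shows "entails C P [A, B, D] \<phi>s \<psi> \<longleftrightarrow> (\<forall>S. stage S \<longrightarrow> (\<forall>x\<in>pt S A. \<forall>y\<in>pt S B. \<forall>z\<in>pt S D.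
    (\<forall>\<phi>\<in>set \<phi>s. forces S [x, y, z] \<phi>) \<longrightarrow> forces S [x, y, z] \<psi>))"
  using assms by (subst entails_iff_forces) (auto simp: list_all2_Cons2)

definition per :: "'o \<times> 'p \<Rightarrow> bool" where
  "per X \<longleftrightarrow> rel_obj X \<and> (\<forall>S x y. eqv X S x y \<longrightarrow> eqv X S y x) \<and>
    (\<forall>S x y z. eqv X S x y \<longrightarrow> eqv X S y z \<longrightarrow> eqv X S x z)"

lemma per_iff: "A \<in> Ob C \<and> is_per C P A \<rho> \<longleftrightarrow> per (A, \<rho>)"
proof (cases "A \<in> Ob C \<and> \<rho> \<in> Pred (Prod C [A, A])")
  case True
  then have A: "A \<in> Ob C" and \<rho>: "\<rho> \<in> Pred (Prod C [A, A])" by auto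
  have typed: "stage S \<and> x \<in> pt S A \<and> y \<in> pt S A" if "eqv (A, \<rho>) S x y" for S x y
    using that by (simp add: eqv_def)
  have wf2: "fm_wf [A, A] (Rel \<rho> [Var 0, Var 1])" "fm_wf [A, A] (Rel \<rho> [Var 1, Var 0])"
    and wf3: "fm_wf [A, A, A] (Rel \<rho> [Var 0, Var 1])" "fm_wf [A, A, A] (Rel \<rho> [Var 1, Var 2])"
      "fm_wf [A, A, A] (Rel \<rho> [Var 0, Var 2])"
    by (auto intro!: fm_wf_Rel2[OF \<rho>] simp del: fm_wf.simps)
  have forces2: "forces S [x, y] (Rel \<rho> [Var 0, Var 1]) \<longleftrightarrow> eqv (A, \<rho>) S x y"
    "forces S [x, y] (Rel \<rho> [Var 1, Var 0]) \<longleftrightarrow> eqv (A, \<rho>) S y x"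
    if "stage S" "x \<in> pt S A" "y \<in> pt S A" for S x y
    using that by (simp_all add: eqv_def)
  have forces3: "forces S [x, y, z] (Rel \<rho> [Var 0, Var 1]) \<longleftrightarrow> eqv (A, \<rho>) S x y"
    "forces S [x, y, z] (Rel \<rho> [Var 1, Var 2]) \<longleftrightarrow> eqv (A, \<rho>) S y z"
    "forces S [x, y, z] (Rel \<rho> [Var 0, Var 2]) \<longleftrightarrow> eqv (A, \<rho>) S x z"
    if "stage S" "x \<in> pt S A" "y \<in> pt S A" "z \<in> pt S A" for S x y z
    using that by (simp_all add: eqv_def)
  have "entails C P [A, A] [Rel \<rho> [Var 0, Var 1]] (Rel \<rho> [Var 1, Var 0]) \<longleftrightarrow>
    (\<forall>S. stage S \<longrightarrow> (\<forall>x\<in>pt S A. \<forall>y\<in>pt S A. eqv (A, \<rho>) S x y \<longrightarrow> eqv (A, \<rho>) S y x))"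
    using A wf2 by (subst entails_ctx2) (auto simp: forces2 simp del: forces.simps fm_wf.simps One_nat_def)
  also have "\<dots> \<longleftrightarrow> (\<forall>S x y. eqv (A, \<rho>) S x y \<longrightarrow> eqv (A, \<rho>) S y x)"
    using typed by blast
  finally have sym: "entails C P [A, A] [Rel \<rho> [Var 0, Var 1]] (Rel \<rho> [Var 1, Var 0]) \<longleftrightarrow>
    (\<forall>S x y. eqv (A, \<rho>) S x y \<longrightarrow> eqv (A, \<rho>) S y x)" .
  have "entails C P [A, A, A] [Rel \<rho> [Var 0, Var 1], Rel \<rho> [Var 1, Var 2]]
      (Rel \<rho> [Var 0, Var 2]) \<longleftrightarrow>
    (\<forall>S. stage S \<longrightarrow> (\<forall>x\<in>pt S A. \<forall>y\<in>pt S A. \<forall>z\<in>pt S A.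
      eqv (A, \<rho>) S x y \<longrightarrow> eqv (A, \<rho>) S y z \<longrightarrow> eqv (A, \<rho>) S x z))"
  proof (subst entails_ctx3[OF A A A])
    show "fm_wf [A, A, A] \<phi>" if "\<phi> \<in> set [Rel \<rho> [Var 0, Var 1], Rel \<rho> [Var 1, Var 2]]" for \<phi>
      using that wf3 by auto
    show "fm_wf [A, A, A] (Rel \<rho> [Var 0, Var 2])" by (rule wf3)
  qed (rule all_cong1, rule imp_cong[OF refl], (rule ball_cong[OF refl])+,
    simp add: forces3 imp_conjL del: forces.simps One_nat_def)
  also have "\<dots> \<longleftrightarrow> (\<forall>S x y z. eqv (A, \<rho>) S x y \<longrightarrow> eqv (A, \<rho>) S y z \<longrightarrow> eqv (A, \<rho>) S x z)"
    using typed by meson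
  finally show ?thesis
    using A \<rho> sym by (simp add: is_per_def per_def rel_obj_def Let_def)
qed (auto simp: is_per_def per_def rel_obj_def)

definition hom :: "'o \<times> 'p \<Rightarrow> 'o \<times> 'p \<Rightarrow> 'm \<Rightarrow> bool" where
  "hom X Y f \<longleftrightarrow> per X \<and> per Y \<and> f \<in> Mor C (fst X) (fst Y) \<and>
    (\<forall>S x y. eqv X S x y \<longrightarrow> eqv Y S (f \<cdot> x) (f \<cdot> y))"

definition reflects :: "'o \<times> 'p \<Rightarrow> 'o \<times> 'p \<Rightarrow> 'm \<Rightarrow> bool" where
  "reflects X Y f \<longleftrightarrow> (\<forall>S x y. eqv X S x x \<longrightarrow> eqv X S y y \<longrightarrow>
    eqv Y S (f \<cdot> x) (f \<cdot> y) \<longrightarrow> eqv X S x y)"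

definition ess_surj :: "'o \<times> 'p \<Rightarrow> 'o \<times> 'p \<Rightarrow> 'm \<Rightarrow> bool" where
  "ess_surj X Y f \<longleftrightarrow> (\<forall>S u. eqv Y S u u \<longrightarrow>
    (\<exists>R p x. covers p R S \<and> eqv X R x x \<and> eqv Y R (f \<cdot> x) (u \<cdot> p)))"

definition lifts :: "'o \<times> 'p \<Rightarrow> 'o \<times> 'p \<Rightarrow> 'm \<Rightarrow> bool" where
  "lifts X Y f \<longleftrightarrow> (\<forall>S x u. eqv X S x x \<longrightarrow> eqv Y S (f \<cdot> x) u \<longrightarrow>
    (\<exists>R p y. covers p R S \<and> eqv X R (x \<cdot> p) y \<and> f \<cdot> y = u \<cdot> p))"

lemma per_rel_obj: "per X \<Longrightarrow> rel_obj X"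
  by (simp add: per_def)

lemma compatible_iff:
  assumes "per X" "per Y"
  shows "compatible C P X Y f \<longleftrightarrow> hom X Y f"
proof (cases "f \<in> Mor C (fst X) (fst Y)")
  case True
  obtain A \<rho> B \<sigma> where XY: "X = (A, \<rho>)" "Y = (B, \<sigma>)" by fastforce
  have f: "f \<in> Mor C A B" and \<rho>: "\<rho> \<in> Pred (Prod C [A, A])" and \<sigma>: "\<sigma> \<in> Pred (Prod C [B, B])"
    using True assms by (simp_all add: XY per_def rel_obj_def)
  note A = Mor_Ob(1)[OF f]
  have wf: "fm_wf [A, A] (Rel \<rho> [Var 0, Var 1])" "fm_wf [A, A] (Rel \<sigma> [Fn f [Var 0], Fn f [Var 1]])"
    by (auto intro!: fm_wf_Rel2[OF \<rho>] fm_wf_Rel2[OF \<sigma>] tm_sort_app[OF f] simp del: fm_wf.simps)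
  have forces: "forces S [x, y] (Rel \<rho> [Var 0, Var 1]) \<longleftrightarrow> eqv (A, \<rho>) S x y"
    "forces S [x, y] (Rel \<sigma> [Fn f [Var 0], Fn f [Var 1]]) \<longleftrightarrow> eqv (B, \<sigma>) S (f \<cdot> x) (f \<cdot> y)"
    if "stage S" "x \<in> pt S A" "y \<in> pt S A" for S x y
    using that Cmp_Mor[OF that(2) f] Cmp_Mor[OF that(3) f] tuple_single[OF that(2)]
      tuple_single[OF that(3)] by (simp_all add: eqv_def)
  have "entails C P [A, A] [Rel \<rho> [Var 0, Var 1]] (Rel \<sigma> [Fn f [Var 0], Fn f [Var 1]]) \<longleftrightarrow>
    (\<forall>S. stage S \<longrightarrow> (\<forall>x\<in>pt S A. \<forall>y\<in>pt S A.
      eqv (A, \<rho>) S x y \<longrightarrow> eqv (B, \<sigma>) S (f \<cdot> x) (f \<cdot> y)))"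
    using A wf by (subst entails_ctx2) (auto simp: forces simp del: forces.simps fm_wf.simps One_nat_def)
  also have "\<dots> \<longleftrightarrow> (\<forall>S x y. eqv (A, \<rho>) S x y \<longrightarrow> eqv (B, \<sigma>) S (f \<cdot> x) (f \<cdot> y))"
  proof -
    have "stage S \<and> x \<in> pt S A \<and> y \<in> pt S A" if "eqv (A, \<rho>) S x y" for S x y
      using that by (simp add: eqv_def)
    then show ?thesis by blast
  qed
  finally show ?thesis using assms f by (simp add: compatible_def XY hom_def Let_def)
qed (auto simp: compatible_def hom_def split_def)

lemma reflects_iff:
  assumes "hom X Y f"
  shows "weq_inj C P X f Y \<longleftrightarrow> reflects X Y f"
proof -
  obtain A \<rho> B \<sigma> where XY: "X = (A, \<rho>)" "Y = (B, \<sigma>)" by fastforce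
  have f: "f \<in> Mor C A B" and \<rho>: "\<rho> \<in> Pred (Prod C [A, A])" and \<sigma>: "\<sigma> \<in> Pred (Prod C [B, B])"
    using assms by (simp_all add: XY hom_def per_def rel_obj_def)
  note A = Mor_Ob(1)[OF f]
  have wf: "fm_wf [A, A] (Rel \<rho> [Var 0, Var 0])" "fm_wf [A, A] (Rel \<rho> [Var 1, Var 1])"
    "fm_wf [A, A] (Rel \<rho> [Var 0, Var 1])" "fm_wf [A, A] (Rel \<sigma> [Fn f [Var 0], Fn f [Var 1]])"
    by (auto intro!: fm_wf_Rel2[OF \<rho>] fm_wf_Rel2[OF \<sigma>] tm_sort_app[OF f] simp del: fm_wf.simps)
  have forces: "forces S [x, y] (Rel \<rho> [Var 0, Var 0]) \<longleftrightarrow> eqv X S x x"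
    "forces S [x, y] (Rel \<rho> [Var 1, Var 1]) \<longleftrightarrow> eqv X S y y"
    "forces S [x, y] (Rel \<rho> [Var 0, Var 1]) \<longleftrightarrow> eqv X S x y"
    "forces S [x, y] (Rel \<sigma> [Fn f [Var 0], Fn f [Var 1]]) \<longleftrightarrow> eqv Y S (f \<cdot> x) (f \<cdot> y)"
    if "stage S" "x \<in> pt S A" "y \<in> pt S A" for S x y
    using that Cmp_Mor[OF that(2) f] Cmp_Mor[OF that(3) f] tuple_single[OF that(2)]
      tuple_single[OF that(3)] by (simp_all add: XY eqv_def)
  have "weq_inj C P X f Y \<longleftrightarrow> entails C P [A, A] [Rel \<rho> [Var 0, Var 0],
      Rel \<sigma> [Fn f [Var 0], Fn f [Var 1]], Rel \<rho> [Var 1, Var 1]] (Rel \<rho> [Var 0, Var 1])"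
    by (simp add: weq_inj_def XY Let_def)
  also have "\<dots> \<longleftrightarrow> (\<forall>S. stage S \<longrightarrow> (\<forall>x\<in>pt S A. \<forall>y\<in>pt S A. eqv X S x x \<longrightarrow> eqv X S y y \<longrightarrow>
      eqv Y S (f \<cdot> x) (f \<cdot> y) \<longrightarrow> eqv X S x y))"
    using A wf by (subst entails_ctx2) (auto simp: forces simp del: forces.simps fm_wf.simps One_nat_def)
  also have "\<dots> \<longleftrightarrow> reflects X Y f"
  proof -
    have "stage S \<and> x \<in> pt S A" if "eqv X S x x" for S x using that by (simp add: XY eqv_def)
    then show ?thesis unfolding reflects_def by blast
  qed
  finally show ?thesis .
qed

lemma ess_surj_iff:
  assumes "hom X Y f"
  shows "weq_esurj C P X f Y \<longleftrightarrow> ess_surj X Y f"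
proof -
  obtain A \<rho> B \<sigma> where XY: "X = (A, \<rho>)" "Y = (B, \<sigma>)" by fastforce
  have f: "f \<in> Mor C A B" and \<rho>: "\<rho> \<in> Pred (Prod C [A, A])" and \<sigma>: "\<sigma> \<in> Pred (Prod C [B, B])"
    using assms by (simp_all add: XY hom_def per_def rel_obj_def)
  note Ob = Mor_Ob[OF f]
  have wf: "fm_wf [B] (Rel \<sigma> [Var 0, Var 0])"
    "fm_wf [B] (Exi A (And (Rel \<rho> [Var 1, Var 1]) (Rel \<sigma> [Fn f [Var 1], Var 0])))"
    using Ob by (auto intro!: fm_wf_Rel2[OF \<rho>] fm_wf_Rel2[OF \<sigma>] tm_sort_app[OF f]
      simp del: fm_wf.simps(1))
  have val: "forces R [v, x] (And (Rel \<rho> [Var 1, Var 1]) (Rel \<sigma> [Fn f [Var 1], Var 0])) \<longleftrightarrow>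
      eqv X R x x \<and> eqv Y R (f \<cdot> x) v"
    if "stage R" "v \<in> pt R B" "x \<in> pt R A" for R v x
    using that Cmp_Mor[OF that(3) f] tuple_single[OF that(3)] by (simp add: XY eqv_def)
  have ex: "forces S [u] (Exi A (And (Rel \<rho> [Var 1, Var 1]) (Rel \<sigma> [Fn f [Var 1], Var 0]))) \<longleftrightarrow>
      (\<exists>R p x. covers p R S \<and> eqv X R x x \<and> eqv Y R (f \<cdot> x) (u \<cdot> p))"
    if u: "u \<in> pt S B" for S u
  proof -
    have "y \<in> pt R A \<and> forces R [u \<cdot> p, y] (And (Rel \<rho> [Var 1, Var 1]) (Rel \<sigma> [Fn f [Var 1], Var 0]))
        \<longleftrightarrow> eqv X R y y \<and> eqv Y R (f \<cdot> y) (u \<cdot> p)" if cov: "covers p R S" for R p y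
    proof -
      note R = refines_stage(1)[OF covers_refines[OF cov]]
        and up = Cmp_Mor[OF refines_pt[OF covers_refines[OF cov]] u]
      have "y \<in> pt R A" if "eqv X R y y" using eqv_pt(1)[OF that] by (simp add: XY)
      then show ?thesis using val[OF R up] by blast
    qed
    then show ?thesis unfolding forces.simps(5) list.map append.simps by blast
  qed
  have hyp: "forces S [u] (Rel \<sigma> [Var 0, Var 0]) \<longleftrightarrow> eqv Y S u u"
    if "stage S" "u \<in> pt S B" for S u
    using that by (simp add: XY eqv_def)
  have "weq_esurj C P X f Y \<longleftrightarrow> entails C P [B] [Rel \<sigma> [Var 0, Var 0]]
      (Exi A (And (Rel \<rho> [Var 1, Var 1]) (Rel \<sigma> [Fn f [Var 1], Var 0])))"
    by (simp add: weq_esurj_def XY Let_def)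
  also have "\<dots> \<longleftrightarrow> (\<forall>S. stage S \<longrightarrow> (\<forall>u\<in>pt S B. eqv Y S u u \<longrightarrow>
      (\<exists>R p x. covers p R S \<and> eqv X R x x \<and> eqv Y R (f \<cdot> x) (u \<cdot> p))))"
    using Ob wf by (subst entails_ctx1) (auto simp: hyp ex simp del: forces.simps fm_wf.simps One_nat_def)
  also have "\<dots> \<longleftrightarrow> ess_surj X Y f"
  proof -
    have "stage S \<and> u \<in> pt S B" if "eqv Y S u u" for S u using that by (simp add: XY eqv_def)
    then show ?thesis unfolding ess_surj_def by blast
  qed
  finally show ?thesis .
qed

text \<open>An equation between witnesses only holds on a further cover; composing the two covers
  turns it into an honest equation of morphisms.\<close>

lemma lifts_iff:
  assumes "hom X Y f"
  shows "fib C P X f Y \<longleftrightarrow> lifts X Y f"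
proof -
  obtain A \<rho> B \<sigma> where XY: "X = (A, \<rho>)" "Y = (B, \<sigma>)" by fastforce
  have f: "f \<in> Mor C A B" and \<rho>: "\<rho> \<in> Pred (Prod C [A, A])" and \<sigma>: "\<sigma> \<in> Pred (Prod C [B, B])"
    and X: "rel_obj X"
    using assms by (simp_all add: XY hom_def per_def rel_obj_def)
  note Ob = Mor_Ob[OF f]
  let ?\<phi> = "And (Rel \<rho> [Var 0, Var 2]) (Equ (Fn f [Var 2]) (Var 1))"
  have wf: "fm_wf [A, B] (Rel \<rho> [Var 0, Var 0])" "fm_wf [A, B] (Rel \<sigma> [Fn f [Var 0], Var 1])"
    "fm_wf [A, B] (Exi A ?\<phi>)"
    using Ob by (auto intro!: fm_wf_Rel2[OF \<rho>] fm_wf_Rel2[OF \<sigma>] tm_sort_app[OF f]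
      fm_wf_Equ[OF tm_sort_app[OF f]] simp del: fm_wf.simps(1,2))
  have val: "forces R [w, v, y] ?\<phi> \<longleftrightarrow>
      eqv X R w y \<and> (\<exists>R' q. covers q R' R \<and> (f \<cdot> y) \<cdot> q = v \<cdot> q)"
    if "stage R" "w \<in> pt R A" "v \<in> pt R B" "y \<in> pt R A" for R v w y
    using that tuple_single[OF that(4)] by (simp add: XY eqv_def)
  have ex: "forces S [x, u] (Exi A ?\<phi>) \<longleftrightarrow>
      (\<exists>R p y. covers p R S \<and> eqv X R (x \<cdot> p) y \<and> f \<cdot> y = u \<cdot> p)" (is "?l \<longleftrightarrow> ?r")
    if x: "x \<in> pt S A" and u: "u \<in> pt S B" for S x u
  proof
    assume ?l
    then obtain R p y where cov: "covers p R S" and y: "y \<in> pt R A"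
      and \<phi>: "forces R [x \<cdot> p, u \<cdot> p, y] ?\<phi>"
      unfolding forces.simps(5) list.map append.simps by blast
    note p = refines_pt[OF covers_refines[OF cov]]
      and R = refines_stage(1)[OF covers_refines[OF cov]]
    obtain R' q where eq: "eqv X R (x \<cdot> p) y" and cov': "covers q R' R"
      and fy: "(f \<cdot> y) \<cdot> q = (u \<cdot> p) \<cdot> q"
      using \<phi> val[OF R Cmp_Mor[OF p x] Cmp_Mor[OF p u] y] by blast
    note q = refines_pt[OF covers_refines[OF cov']]
    have "eqv X R' ((x \<cdot> p) \<cdot> q) (y \<cdot> q)" by (rule eqv_refine[OF X covers_refines[OF cov'] eq])
    then have "eqv X R' (x \<cdot> (p \<cdot> q)) (y \<cdot> q)" using Cmp_assoc[OF q p x] by simp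
    moreover have "f \<cdot> (y \<cdot> q) = u \<cdot> (p \<cdot> q)"
      using fy Cmp_assoc[OF q y f] Cmp_assoc[OF q p u] by simp
    ultimately show ?r using covers_trans[OF cov' cov] by blast
  next
    assume ?r
    then obtain R p y where cov: "covers p R S" and eq: "eqv X R (x \<cdot> p) y" and fy: "f \<cdot> y = u \<cdot> p"
      by blast
    note p = refines_pt[OF covers_refines[OF cov]] and R = eqv_stage[OF eq]
    have y: "y \<in> pt R A" using eqv_pt(2)[OF eq] by (simp add: XY)
    have "forces R [x \<cdot> p, u \<cdot> p, y] ?\<phi>"
      unfolding val[OF R Cmp_Mor[OF p x] Cmp_Mor[OF p u] y] fy using eq covers_id[OF R] by blast
    with cov y show ?l unfolding forces.simps(5) list.map append.simps by blast
  qed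
  have "forces S [x, u] (Rel \<rho> [Var 0, Var 0]) \<longleftrightarrow> eqv X S x x"
    "forces S [x, u] (Rel \<sigma> [Fn f [Var 0], Var 1]) \<longleftrightarrow> eqv Y S (f \<cdot> x) u"
    if "stage S" "x \<in> pt S A" "u \<in> pt S B" for S x u
    using that Cmp_Mor[OF that(2) f] tuple_single[OF that(2)] by (simp_all add: XY eqv_def)
  note forces = this ex
  have "fib C P X f Y \<longleftrightarrow> entails C P [A, B]
      [Rel \<rho> [Var 0, Var 0], Rel \<sigma> [Fn f [Var 0], Var 1]] (Exi A ?\<phi>)"
    by (simp add: fib_def XY Let_def)
  also have "\<dots> \<longleftrightarrow> (\<forall>S. stage S \<longrightarrow> (\<forall>x\<in>pt S A. \<forall>u\<in>pt S B. eqv X S x x \<longrightarrow> eqv Y S (f \<cdot> x) u \<longrightarrow>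
      (\<exists>R p y. covers p R S \<and> eqv X R (x \<cdot> p) y \<and> f \<cdot> y = u \<cdot> p)))"
    using Ob wf by (subst entails_ctx2) (auto simp: forces simp del: forces.simps fm_wf.simps One_nat_def)
  also have "\<dots> \<longleftrightarrow> lifts X Y f"
  proof -
    have "stage S \<and> x \<in> pt S A \<and> u \<in> pt S B" if "eqv X S x x" "eqv Y S (f \<cdot> x) u" for S x u
      using eqv_pt(1)[OF that(1)] eqv_pt(2)[OF that(2)] eqv_stage[OF that(1)] by (simp add: XY)
    then show ?thesis unfolding lifts_def by blast
  qed
  finally show ?thesis .
qed

lemma eqv_sym: "\<lbrakk>per X; eqv X S x y\<rbrakk> \<Longrightarrow> eqv X S y x"
  unfolding per_def by blast

lemma eqv_trans: "\<lbrakk>per X; eqv X S x y; eqv X S y z\<rbrakk> \<Longrightarrow> eqv X S x z"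
  unfolding per_def by blast

lemma eqv_refl: "\<lbrakk>per X; eqv X S x y\<rbrakk> \<Longrightarrow> eqv X S x x" "\<lbrakk>per X; eqv X S x y\<rbrakk> \<Longrightarrow> eqv X S y y"
  using eqv_sym eqv_trans by blast+

lemma hom_eqv: "\<lbrakk>hom X Y f; eqv X S x y\<rbrakk> \<Longrightarrow> eqv Y S (f \<cdot> x) (f \<cdot> y)"
  and hom_per: "hom X Y f \<Longrightarrow> per X" "hom X Y f \<Longrightarrow> per Y"
  and hom_Mor: "hom X Y f \<Longrightarrow> f \<in> Mor C (fst X) (fst Y)"
  unfolding hom_def by blast+

lemma eqv_cover:
  assumes "per X" "covers p R S" "eqv X S x y"
  shows "eqv X R (x \<cdot> p) (y \<cdot> p)"
  using eqv_refine[OF per_rel_obj covers_refines] assms by blast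

lemma hom_cover_assoc:
  assumes f: "hom X Y f" and c: "covers p R S" and x: "x \<in> pt S (fst X)"
  shows "(f \<cdot> x) \<cdot> p = f \<cdot> (x \<cdot> p)"
  using Cmp_assoc[OF refines_pt[OF covers_refines[OF c]] x hom_Mor[OF f]] .

lemma covers_assoc:
  assumes "covers q R' R" "covers p R S" "x \<in> pt S A"
  shows "(x \<cdot> p) \<cdot> q = x \<cdot> (p \<cdot> q)"
  using Cmp_assoc[OF refines_pt[OF covers_refines[OF assms(1)]]
    refines_pt[OF covers_refines[OF assms(2)]] assms(3)] by simp

lemma comp_pt:
  assumes "hom X Y f" "hom Y Z g" "x \<in> pt S (fst X)"
  shows "(g \<cdot> f) \<cdot> x = g \<cdot> (f \<cdot> x)"
  using Cmp_assoc[OF assms(3) hom_Mor[OF assms(1)] hom_Mor[OF assms(2)]] .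

lemma hom_id:
  assumes "per X" shows "hom X X (Idn C (fst X))"
proof -
  have X: "fst X \<in> Ob C" using assms by (simp add: per_def rel_obj_def)
  have "eqv X S (Idn C (fst X) \<cdot> x) (Idn C (fst X) \<cdot> y)" if "eqv X S x y" for S x y
    using that Idn_Cmp[OF eqv_pt(1)[OF that]] Idn_Cmp[OF eqv_pt(2)[OF that]] by simp
  then show ?thesis using assms Idn_Mor[OF X] by (simp add: hom_def)
qed

lemma hom_comp:
  assumes f: "hom X Y f" and g: "hom Y Z g"
  shows "hom X Z (g \<cdot> f)"
  unfolding hom_def
proof (intro conjI allI impI)
  show "per X" "per Z" "g \<cdot> f \<in> Mor C (fst X) (fst Z)"
    using f g Cmp_Mor[OF hom_Mor[OF f] hom_Mor[OF g]] hom_per by blast+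
  fix S x y assume xy: "eqv X S x y"
  then show "eqv Z S ((g \<cdot> f) \<cdot> x) ((g \<cdot> f) \<cdot> y)"
    using hom_eqv[OF g hom_eqv[OF f xy]] comp_pt[OF f g] eqv_pt[OF xy] by simp
qed


section \<open>Weak equivalences and fibrations\<close>

definition weq :: "'o \<times> 'p \<Rightarrow> 'o \<times> 'p \<Rightarrow> 'm \<Rightarrow> bool" where
  "weq X Y f \<longleftrightarrow> hom X Y f \<and> reflects X Y f \<and> ess_surj X Y f"

definition fibn :: "'o \<times> 'p \<Rightarrow> 'o \<times> 'p \<Rightarrow> 'm \<Rightarrow> bool" where
  "fibn X Y f \<longleftrightarrow> hom X Y f \<and> lifts X Y f"

lemma weq_hom: "weq X Y f \<Longrightarrow> hom X Y f" and fibn_hom: "fibn X Y f \<Longrightarrow> hom X Y f"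
  by (simp_all add: weq_def fibn_def)

lemma weqI:
  assumes "hom X Y f"
    and "\<And>S x y. \<lbrakk>eqv X S x x; eqv X S y y; eqv Y S (f \<cdot> x) (f \<cdot> y)\<rbrakk> \<Longrightarrow> eqv X S x y"
    and "\<And>S u. eqv Y S u u \<Longrightarrow> \<exists>R p x. covers p R S \<and> eqv X R x x \<and> eqv Y R (f \<cdot> x) (u \<cdot> p)"
  shows "weq X Y f"
  using assms by (simp add: weq_def reflects_def ess_surj_def)

lemma fibnI:
  assumes "hom X Y f"
    and "\<And>S x u. \<lbrakk>eqv X S x x; eqv Y S (f \<cdot> x) u\<rbrakk> \<Longrightarrow>
      \<exists>R p y. covers p R S \<and> eqv X R (x \<cdot> p) y \<and> f \<cdot> y = u \<cdot> p"
  shows "fibn X Y f"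
  using assms by (simp add: fibn_def lifts_def)

lemma weq_reflects:
  "\<lbrakk>weq X Y f; eqv X S x x; eqv X S y y; eqv Y S (f \<cdot> x) (f \<cdot> y)\<rbrakk> \<Longrightarrow> eqv X S x y"
  unfolding weq_def reflects_def by blast

lemma weq_surj:
  assumes "weq X Y f" "eqv Y S u u"
  obtains R p x where "covers p R S" "eqv X R x x" "eqv Y R (f \<cdot> x) (u \<cdot> p)"
  using assms unfolding weq_def ess_surj_def by blast

lemma fibn_lift:
  assumes "fibn X Y f" "eqv X S x x" "eqv Y S (f \<cdot> x) u"
  obtains R p y where "covers p R S" "eqv X R (x \<cdot> p) y" "f \<cdot> y = u \<cdot> p"
  using assms unfolding fibn_def lifts_def by blast

text \<open>For witnesses that exist outright: they are found on the identity cover, which changes no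
  element.\<close>

lemma covers_self:
  assumes "stage S"
  obtains p where "covers p S S" "\<And>x A. x \<in> pt S A \<Longrightarrow> x \<cdot> p = x"
  using that[OF covers_id[OF assms]] Cmp_Idn by blast

lemma iso_weq_fibn:
  assumes f: "hom X Y f" and g: "hom Y X g"
    and gf: "g \<cdot> f = Idn C (fst X)" and fg: "f \<cdot> g = Idn C (fst Y)"
  shows "weq X Y f" "fibn X Y f"
proof -
  have gfx: "g \<cdot> (f \<cdot> x) = x" if "x \<in> pt S (fst X)" for S x
    using comp_pt[OF f g that] gf Idn_Cmp[OF that] by simp
  have fgu: "f \<cdot> (g \<cdot> u) = u" if "u \<in> pt S (fst Y)" for S u
    using comp_pt[OF g f that] fg Idn_Cmp[OF that] by simp
  show "weq X Y f"
  proof (rule weqI[OF f])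
    fix S x y assume x: "eqv X S x x" and y: "eqv X S y y" and fxy: "eqv Y S (f \<cdot> x) (f \<cdot> y)"
    show "eqv X S x y" using hom_eqv[OF g fxy] gfx[OF eqv_pt(1)[OF x]] gfx[OF eqv_pt(1)[OF y]] by simp
  next
    fix S u assume u: "eqv Y S u u"
    note pt = eqv_pt(1)[OF u]
    obtain p where "covers p S S" and p: "\<And>x A. x \<in> pt S A \<Longrightarrow> x \<cdot> p = x"
      using covers_self[OF eqv_stage[OF u]] by blast
    moreover have "eqv X S (g \<cdot> u) (g \<cdot> u)" by (rule hom_eqv[OF g u])
    moreover have "eqv Y S (f \<cdot> (g \<cdot> u)) (u \<cdot> p)" using u fgu[OF pt] p[OF pt] by simp
    ultimately show "\<exists>R p x. covers p R S \<and> eqv X R x x \<and> eqv Y R (f \<cdot> x) (u \<cdot> p)" by blast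
  qed
  show "fibn X Y f"
  proof (rule fibnI[OF f])
    fix S x u assume x: "eqv X S x x" and fxu: "eqv Y S (f \<cdot> x) u"
    note px = eqv_pt(1)[OF x] and pu = eqv_pt(2)[OF fxu]
    obtain p where "covers p S S" and p: "\<And>x A. x \<in> pt S A \<Longrightarrow> x \<cdot> p = x"
      using covers_self[OF eqv_stage[OF x]] by blast
    moreover have "eqv X S (x \<cdot> p) (g \<cdot> u)" using hom_eqv[OF g fxu] gfx[OF px] p[OF px] by simp
    moreover have "f \<cdot> (g \<cdot> u) = u \<cdot> p" using fgu[OF pu] p[OF pu] by simp
    ultimately show "\<exists>R p y. covers p R S \<and> eqv X R (x \<cdot> p) y \<and> f \<cdot> y = u \<cdot> p" by blast
  qed
qed

lemma weq_comp:
  assumes f: "weq X Y f" and g: "weq Y Z g"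
  shows "weq X Z (g \<cdot> f)"
proof (rule weqI)
  note hf = weq_hom[OF f] and hg = weq_hom[OF g]
  show "hom X Z (g \<cdot> f)" by (rule hom_comp[OF hf hg])
  {
    fix S x y assume x: "eqv X S x x" and y: "eqv X S y y"
      and eq: "eqv Z S ((g \<cdot> f) \<cdot> x) ((g \<cdot> f) \<cdot> y)"
    have "eqv Z S (g \<cdot> (f \<cdot> x)) (g \<cdot> (f \<cdot> y))"
      using eq comp_pt[OF hf hg] eqv_pt(1)[OF x] eqv_pt(1)[OF y] by simp
    from weq_reflects[OF f x y weq_reflects[OF g hom_eqv[OF hf x] hom_eqv[OF hf y] this]]
    show "eqv X S x y" .
  }
  fix S w assume w: "eqv Z S w w"
  obtain R p u where p: "covers p R S" and u: "eqv Y R u u" "eqv Z R (g \<cdot> u) (w \<cdot> p)"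
    using weq_surj[OF g w] .
  obtain R' q x where q: "covers q R' R" and x: "eqv X R' x x" "eqv Y R' (f \<cdot> x) (u \<cdot> q)"
    using weq_surj[OF f u(1)] .
  have "eqv Z R' (g \<cdot> (f \<cdot> x)) (g \<cdot> (u \<cdot> q))" by (rule hom_eqv[OF hg x(2)])
  moreover have "eqv Z R' (g \<cdot> (u \<cdot> q)) (w \<cdot> (p \<cdot> q))"
    using eqv_cover[OF hom_per(2)[OF hg] q u(2)] hom_cover_assoc[OF hg q eqv_pt(1)[OF u(1)]]
      covers_assoc[OF q p eqv_pt(1)[OF w]] by simp
  ultimately have "eqv Z R' ((g \<cdot> f) \<cdot> x) (w \<cdot> (p \<cdot> q))"
    using eqv_trans[OF hom_per(2)[OF hg]] comp_pt[OF hf hg eqv_pt(1)[OF x(1)]] by simp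
  then show "\<exists>R p x. covers p R S \<and> eqv X R x x \<and> eqv Z R ((g \<cdot> f) \<cdot> x) (w \<cdot> p)"
    using covers_trans[OF q p] x(1) by blast
qed

text \<open>To see that \<open>g\<close> reflects the relation, replace the given elements \<open>u, v\<close> of \<open>Y\<close>, one after
  the other, by images of elements of \<open>X\<close> on a cover; the conclusion descends from the cover.\<close>

lemma weq_cancel_right:
  assumes f: "weq X Y f" and hg: "hom Y Z g" and gf: "weq X Z (g \<cdot> f)"
  shows "weq Y Z g"
proof (rule weqI[OF hg])
  note hf = weq_hom[OF f]
  have Y: "per Y" and Z: "per Z" using hom_per[OF hg] by blast+
  {
    fix S u v assume u: "eqv Y S u u" and v: "eqv Y S v v" and eq: "eqv Z S (g \<cdot> u) (g \<cdot> v)"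
    obtain R p x where p: "covers p R S" and x: "eqv X R x x" "eqv Y R (f \<cdot> x) (u \<cdot> p)"
      using weq_surj[OF f u] .
    obtain R' q y where q: "covers q R' R" and y: "eqv X R' y y" "eqv Y R' (f \<cdot> y) ((v \<cdot> p) \<cdot> q)"
      using weq_surj[OF f eqv_cover[OF Y p v]] .
    have xq: "eqv X R' (x \<cdot> q) (x \<cdot> q)" "eqv Y R' (f \<cdot> (x \<cdot> q)) ((u \<cdot> p) \<cdot> q)"
      using eqv_cover[OF hom_per(1)[OF hf] q x(1)] eqv_cover[OF Y q x(2)]
        hom_cover_assoc[OF hf q eqv_pt(1)[OF x(1)]] by simp_all
    have up: "u \<cdot> p \<in> pt R (fst Y)" and vp: "v \<cdot> p \<in> pt R (fst Y)"
      using eqv_pt(1)[OF eqv_cover[OF Y p u]] eqv_pt(1)[OF eqv_cover[OF Y p v]] .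
    have "eqv Z R' (g \<cdot> ((u \<cdot> p) \<cdot> q)) (g \<cdot> ((v \<cdot> p) \<cdot> q))"
      using eqv_cover[OF Z q eqv_cover[OF Z p eq]] hom_cover_assoc[OF hg q up]
        hom_cover_assoc[OF hg q vp] hom_cover_assoc[OF hg p eqv_pt(1)[OF u]]
        hom_cover_assoc[OF hg p eqv_pt(1)[OF v]] by simp
    with hom_eqv[OF hg xq(2)] hom_eqv[OF hg eqv_sym[OF Y y(2)]]
    have "eqv Z R' (g \<cdot> (f \<cdot> (x \<cdot> q))) (g \<cdot> (f \<cdot> y))" using eqv_trans[OF Z] by blast
    then have "eqv X R' (x \<cdot> q) y"
      using weq_reflects[OF gf xq(1) y(1)] comp_pt[OF hf hg] eqv_pt(1)[OF xq(1)] eqv_pt(1)[OF y(1)]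
      by simp
    from hom_eqv[OF hf this] have "eqv Y R' ((u \<cdot> p) \<cdot> q) ((v \<cdot> p) \<cdot> q)"
      using eqv_trans[OF Y] eqv_sym[OF Y xq(2)] y(2) by blast
    then have "eqv Y R' (u \<cdot> (p \<cdot> q)) (v \<cdot> (p \<cdot> q))"
      using covers_assoc[OF q p] eqv_pt(1)[OF u] eqv_pt(1)[OF v] by simp
    then show "eqv Y S u v"
      using eqv_local[OF per_rel_obj[OF Y] covers_trans[OF q p]] eqv_pt(1)[OF u] eqv_pt(1)[OF v] by blast
  }
  fix S w assume w: "eqv Z S w w"
  obtain R p x where p: "covers p R S" and x: "eqv X R x x" "eqv Z R ((g \<cdot> f) \<cdot> x) (w \<cdot> p)"
    using weq_surj[OF gf w] .
  have "eqv Z R (g \<cdot> (f \<cdot> x)) (w \<cdot> p)" using x(2) comp_pt[OF hf hg eqv_pt(1)[OF x(1)]] by simp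
  then show "\<exists>R p u. covers p R S \<and> eqv Y R u u \<and> eqv Z R (g \<cdot> u) (w \<cdot> p)"
    using p hom_eqv[OF hf x(1)] by blast
qed

lemma weq_cancel_left:
  assumes hf: "hom X Y f" and g: "weq Y Z g" and gf: "weq X Z (g \<cdot> f)"
  shows "weq X Y f"
proof (rule weqI[OF hf])
  note hg = weq_hom[OF g]
  {
    fix S x y assume x: "eqv X S x x" and y: "eqv X S y y" and eq: "eqv Y S (f \<cdot> x) (f \<cdot> y)"
    show "eqv X S x y"
      using weq_reflects[OF gf x y] hom_eqv[OF hg eq] comp_pt[OF hf hg] eqv_pt(1)[OF x] eqv_pt(1)[OF y]
      by simp
  }
  fix S u assume u: "eqv Y S u u"
  obtain R p x where p: "covers p R S" and x: "eqv X R x x" "eqv Z R ((g \<cdot> f) \<cdot> x) (g \<cdot> u \<cdot> p)"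
    using weq_surj[OF gf hom_eqv[OF hg u]] hom_cover_assoc[OF hg _ eqv_pt(1)[OF u]] by metis
  have "eqv Z R (g \<cdot> (f \<cdot> x)) (g \<cdot> (u \<cdot> p))" using x(2) comp_pt[OF hf hg eqv_pt(1)[OF x(1)]] by simp
  then have "eqv Y R (f \<cdot> x) (u \<cdot> p)"
    using weq_reflects[OF g hom_eqv[OF hf x(1)] eqv_cover[OF hom_per(1)[OF hg] p u]] by blast
  then show "\<exists>R p x. covers p R S \<and> eqv X R x x \<and> eqv Y R (f \<cdot> x) (u \<cdot> p)"
    using p x(1) by blast
qed

lemma fibn_comp:
  assumes f: "fibn X Y f" and g: "fibn Y Z g"
  shows "fibn X Z (g \<cdot> f)"
proof (rule fibnI)
  note hf = fibn_hom[OF f] and hg = fibn_hom[OF g]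
  have X: "per X" using hom_per[OF hf] by blast
  show "hom X Z (g \<cdot> f)" by (rule hom_comp[OF hf hg])
  fix S x w assume x: "eqv X S x x" and eq: "eqv Z S ((g \<cdot> f) \<cdot> x) w"
  note px = eqv_pt(1)[OF x]
  have "eqv Z S (g \<cdot> (f \<cdot> x)) w" using eq comp_pt[OF hf hg px] by simp
  then obtain R p u where p: "covers p R S" and u: "eqv Y R ((f \<cdot> x) \<cdot> p) u" "g \<cdot> u = w \<cdot> p"
    by (rule fibn_lift[OF g hom_eqv[OF hf x]])
  have "eqv Y R (f \<cdot> (x \<cdot> p)) u" using u(1) hom_cover_assoc[OF hf p px] by simp
  then obtain R' q y where q: "covers q R' R" and y: "eqv X R' ((x \<cdot> p) \<cdot> q) y" "f \<cdot> y = u \<cdot> q"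
    by (rule fibn_lift[OF f eqv_cover[OF X p x]])
  have "(g \<cdot> f) \<cdot> y = (g \<cdot> u) \<cdot> q"
    using comp_pt[OF hf hg eqv_pt(2)[OF y(1)]] y(2) hom_cover_assoc[OF hg q eqv_pt(2)[OF u(1)]] by simp
  also have "\<dots> = w \<cdot> (p \<cdot> q)" using u(2) covers_assoc[OF q p eqv_pt(2)[OF eq]] by simp
  finally have "(g \<cdot> f) \<cdot> y = w \<cdot> (p \<cdot> q)" .
  moreover have "eqv X R' (x \<cdot> (p \<cdot> q)) y" using y(1) covers_assoc[OF q p px] by simp
  ultimately show "\<exists>R p y. covers p R S \<and> eqv X R (x \<cdot> p) y \<and> (g \<cdot> f) \<cdot> y = w \<cdot> p"
    using covers_trans[OF q p] by blast
qed


section \<open>Pullbacks and path objects\<close>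

text \<open>The predicate \<open>\<rho>(h x, k y)\<close> in two variables \<open>x, y\<close> of sort \<open>Q\<close>.\<close>

definition inverse_pred :: "'o \<Rightarrow> 'm \<Rightarrow> 'm \<Rightarrow> 'p \<Rightarrow> 'p" where
  "inverse_pred Q h k \<rho> = Reidx P (tuple C (Prod C [Q, Q])
    [h \<cdot> Proj C [Q, Q] 0, k \<cdot> Proj C [Q, Q] 1]) \<rho>"

lemma inverse_pred:
  assumes X: "rel_obj X" and h: "h \<in> Mor C Q (fst X)" and k: "k \<in> Mor C Q (fst X)"
  shows "inverse_pred Q h k (snd X) \<in> Pred (Prod C [Q, Q])"
    and "\<lbrakk>stage S; x \<in> pt S Q; y \<in> pt S Q\<rbrakk> \<Longrightarrow>
      holds S (tuple C (fst S) [x, y]) (inverse_pred Q h k (snd X)) \<longleftrightarrow> eqv X S (h \<cdot> x) (k \<cdot> y)"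
proof -
  note Q = Mor_Ob(1)[OF h]
  have pr: "Proj C [Q, Q] 0 \<in> Mor C (Prod C [Q, Q]) Q" "Proj C [Q, Q] 1 \<in> Mor C (Prod C [Q, Q]) Q"
    using Proj_Mor[of "[Q, Q]" 0] Proj_Mor[of "[Q, Q]" 1] Q by simp_all
  note hp = Cmp_Mor[OF pr(1) h] and kp = Cmp_Mor[OF pr(2) k]
  note m = pair_Mor(1)[OF hp kp]
  have \<rho>: "snd X \<in> Pred (Prod C [fst X, fst X])" using X by (simp add: rel_obj_def)
  show "inverse_pred Q h k (snd X) \<in> Pred (Prod C [Q, Q])"
    unfolding inverse_pred_def by (rule Reidx_closed[OF m \<rho>])
  assume S: "stage S" and x: "x \<in> pt S Q" and y: "y \<in> pt S Q"
  let ?xy = "tuple C (fst S) [x, y]"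
  note xy = pair_Mor(1)[OF x y]
  have "Proj C [Q, Q] 0 \<cdot> ?xy = x" "Proj C [Q, Q] 1 \<cdot> ?xy = y"
    using Proj_tuple[OF Mor_Ob(1)[OF x], of "[x, y]" "[Q, Q]"] x y by force+
  then have "tuple C (Prod C [Q, Q]) [h \<cdot> Proj C [Q, Q] 0, k \<cdot> Proj C [Q, Q] 1] \<cdot> ?xy =
      tuple C (fst S) [h \<cdot> x, k \<cdot> y]"
    using pair_Mor(2)[OF hp kp xy] Cmp_assoc[OF xy pr(1) h] Cmp_assoc[OF xy pr(2) k] by simp
  then show "holds S ?xy (inverse_pred Q h k (snd X)) \<longleftrightarrow> eqv X S (h \<cdot> x) (k \<cdot> y)"
    using holds_Reidx[OF m xy \<rho>] S Cmp_Mor[OF x h] Cmp_Mor[OF y k]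
    by (simp add: inverse_pred_def eqv_def)
qed

lemma eqv_meet:
  assumes "rel_obj (Q, \<rho>)" "rel_obj (Q, \<sigma>)"
  shows "rel_obj (Q, \<rho> \<sqinter>\<^bsub>Fib P (Prod C [Q, Q])\<^esub> \<sigma>)"
    and "eqv (Q, \<rho> \<sqinter>\<^bsub>Fib P (Prod C [Q, Q])\<^esub> \<sigma>) S x y \<longleftrightarrow> eqv (Q, \<rho>) S x y \<and> eqv (Q, \<sigma>) S x y"
  using assms meet_Pred[OF Prod_Ob, of "[Q, Q]" \<rho> \<sigma>] holds_meet[OF _ pair_Mor(1), of S x Q y Q \<rho> \<sigma>]
  by (auto simp: rel_obj_def eqv_def)

text \<open>The largest relation on \<open>Q\<close> that makes both \<open>h\<close> and \<open>k\<close> compatible.  Both the pullbacks and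
  the products of partial equivalence relations are of this form.\<close>

definition joint :: "'o \<Rightarrow> 'm \<Rightarrow> 'o \<times> 'p \<Rightarrow> 'm \<Rightarrow> 'o \<times> 'p \<Rightarrow> 'o \<times> 'p" where
  "joint Q h X k Y = (Q, inverse_pred Q h h (snd X) \<sqinter>\<^bsub>Fib P (Prod C [Q, Q])\<^esub>
    inverse_pred Q k k (snd Y))"

lemma fst_joint [simp]: "fst (joint Q h X k Y) = Q"
  by (simp add: joint_def)

lemma joint:
  assumes X: "per X" and Y: "per Y" and h: "h \<in> Mor C Q (fst X)" and k: "k \<in> Mor C Q (fst Y)"
  shows "per (joint Q h X k Y)"
    and "eqv (joint Q h X k Y) S x y \<longleftrightarrow> x \<in> pt S Q \<and> y \<in> pt S Q \<and>
      eqv X S (h \<cdot> x) (h \<cdot> y) \<and> eqv Y S (k \<cdot> x) (k \<cdot> y)"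
proof -
  have Q: "Q \<in> Ob C" using Mor_Ob(1)[OF h] .
  note hi = inverse_pred[OF per_rel_obj[OF X] h h] and ki = inverse_pred[OF per_rel_obj[OF Y] k k]
  have rel: "rel_obj (Q, inverse_pred Q h h (snd X))" "rel_obj (Q, inverse_pred Q k k (snd Y))"
    using Q hi(1) ki(1) by (simp_all add: rel_obj_def)
  have eqv: "eqv (joint Q h X k Y) S x y \<longleftrightarrow> x \<in> pt S Q \<and> y \<in> pt S Q \<and>
      eqv X S (h \<cdot> x) (h \<cdot> y) \<and> eqv Y S (k \<cdot> x) (k \<cdot> y)" for S x y
    using eqv_meet(2)[OF rel, of S x y] hi(2)[of S x y] ki(2)[of S x y] eqv_stage[of X S "h \<cdot> x" "h \<cdot> y"]
    by (auto simp: joint_def eqv_def[of "(Q, _)"])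
  then show "eqv (joint Q h X k Y) S x y \<longleftrightarrow> x \<in> pt S Q \<and> y \<in> pt S Q \<and>
      eqv X S (h \<cdot> x) (h \<cdot> y) \<and> eqv Y S (k \<cdot> x) (k \<cdot> y)" .
  have "rel_obj (joint Q h X k Y)" using eqv_meet(1)[OF rel] by (simp add: joint_def)
  then show "per (joint Q h X k Y)"
    unfolding per_def eqv using eqv_sym[OF X] eqv_sym[OF Y] eqv_trans[OF X] eqv_trans[OF Y] by blast
qed

lemma joint_hom:
  assumes X: "per X" and Y: "per Y" and h: "h \<in> Mor C Q (fst X)" and k: "k \<in> Mor C Q (fst Y)"
  shows "hom (joint Q h X k Y) X h" "hom (joint Q h X k Y) Y k"
  using assms joint[OF assms] by (simp_all add: hom_def)

lemma hom_joint:
  assumes X: "per X" and Y: "per Y" and h: "h \<in> Mor C Q (fst X)" and k: "k \<in> Mor C Q (fst Y)"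
    and w: "w \<in> Mor C (fst Z) Q" and hw: "hom Z X (h \<cdot> w)" and kw: "hom Z Y (k \<cdot> w)"
  shows "hom Z (joint Q h X k Y) w"
proof -
  have "eqv (joint Q h X k Y) S (w \<cdot> x) (w \<cdot> y)" if xy: "eqv Z S x y" for S x y
    using hom_eqv[OF hw xy] hom_eqv[OF kw xy] eqv_pt[OF xy] joint(2)[OF X Y h k]
      Cmp_Mor[OF _ w] Cmp_assoc[OF _ w h] Cmp_assoc[OF _ w k] by simp
  then show ?thesis using joint(1)[OF X Y h k] w hom_per[OF hw] by (simp add: hom_def)
qed

text \<open>Moving the first component of an element of the pullback to a related element \<open>a\<close> makes its
  components agree in \<open>Y\<close> only up to the relation of \<open>Y\<close>.  Lifting along \<open>g\<close> moves the second
  component too, after which they agree strictly and form an element of the pullback again.\<close>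

lemma pullback_fibn:
  assumes f: "hom X Y f" and g: "fibn Z Y g" and pb: "is_pullback C f g h k"
  shows "fibn (joint (Src C h) h X k Z) X h"
proof -
  let ?Q = "Src C h" let ?J = "joint ?Q h X k Z"
  note hg = fibn_hom[OF g]
  have X: "per X" and Y: "per Y" and Z: "per Z" using hom_per f hg by blast+
  have h: "h \<in> Mor C ?Q (fst X)" and k: "k \<in> Mor C ?Q (fst Z)" and comm: "f \<cdot> h = g \<cdot> k"
    using pb hom_Mor[OF f] hom_Mor[OF hg] by (auto simp: is_pullback_def Mor_def)
  note J = joint[OF X Z h k] and hJ = joint_hom[OF X Z h k]
  show ?thesis
  proof (rule fibnI[OF hJ(1)])
    fix S x a assume x: "eqv ?J S x x" and eq: "eqv X S (h \<cdot> x) a"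
    have pt: "x \<in> pt S ?Q" using eqv_pt(1)[OF x] by simp
    have kx: "eqv Z S (k \<cdot> x) (k \<cdot> x)" using x J(2) by simp
    have "f \<cdot> (h \<cdot> x) = g \<cdot> (k \<cdot> x)"
      using Cmp_assoc[OF pt h hom_Mor[OF f]] Cmp_assoc[OF pt k hom_Mor[OF hg]] comm by simp
    with hom_eqv[OF f eq] have "eqv Y S (g \<cdot> (k \<cdot> x)) (f \<cdot> a)" by simp
    then obtain R p d where p: "covers p R S" and d: "eqv Z R ((k \<cdot> x) \<cdot> p) d" "g \<cdot> d = (f \<cdot> a) \<cdot> p"
      by (rule fibn_lift[OF g kx])
    note pp = refines_pt[OF covers_refines[OF p]]
    have ap: "a \<cdot> p \<in> pt R (fst X)" using Cmp_Mor[OF pp eqv_pt(2)[OF eq]] .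
    have "f \<cdot> (a \<cdot> p) = g \<cdot> d" using d(2) hom_cover_assoc[OF f p eqv_pt(2)[OF eq]] by simp
    then obtain y where y: "y \<in> pt R ?Q" "h \<cdot> y = a \<cdot> p" "k \<cdot> y = d"
      using pullback_lift[OF pb, of "a \<cdot> p" "fst R" d] ap eqv_pt(2)[OF d(1)]
        MorD(2)[OF hom_Mor[OF f]] MorD(2)[OF hom_Mor[OF hg]] by auto
    have "eqv ?J R (x \<cdot> p) y"
      using J(2) Cmp_Mor[OF pp pt] y eqv_cover[OF X p eq] d(1)
        hom_cover_assoc[OF hJ(1) p] hom_cover_assoc[OF hJ(2) p] pt by simp
    then show "\<exists>R p y. covers p R S \<and> eqv ?J R (x \<cdot> p) y \<and> h \<cdot> y = a \<cdot> p"
      using p y(2) by blast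
  qed
qed

text \<open>Essential surjectivity of \<open>g\<close> yields an element whose image is related to \<open>f a\<close>; being a
  fibration, \<open>g\<close> lets it be replaced by one whose image is equal to \<open>f a\<close>.\<close>

lemma pullback_weq:
  assumes f: "hom X Y f" and g: "fibn Z Y g" and w: "weq Z Y g" and pb: "is_pullback C f g h k"
  shows "weq (joint (Src C h) h X k Z) X h"
proof -
  let ?Q = "Src C h" let ?J = "joint ?Q h X k Z"
  note hg = fibn_hom[OF g]
  have X: "per X" and Y: "per Y" and Z: "per Z" using hom_per f hg by blast+
  have h: "h \<in> Mor C ?Q (fst X)" and k: "k \<in> Mor C ?Q (fst Z)" and comm: "f \<cdot> h = g \<cdot> k"
    using pb hom_Mor[OF f] hom_Mor[OF hg] by (auto simp: is_pullback_def Mor_def)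
  note J = joint[OF X Z h k] and hJ = joint_hom[OF X Z h k]
  show ?thesis
  proof (rule weqI[OF hJ(1)])
    fix S x y assume x: "eqv ?J S x x" and y: "eqv ?J S y y" and eq: "eqv X S (h \<cdot> x) (h \<cdot> y)"
    have fh: "f \<cdot> (h \<cdot> v) = g \<cdot> (k \<cdot> v)" if v: "v \<in> pt S ?Q" for v
      using Cmp_assoc[OF v h hom_Mor[OF f]] Cmp_assoc[OF v k hom_Mor[OF hg]] comm by simp
    have pt: "x \<in> pt S ?Q" "y \<in> pt S ?Q" using x y J(2) by simp_all
    have "eqv Y S (g \<cdot> (k \<cdot> x)) (g \<cdot> (k \<cdot> y))" using hom_eqv[OF f eq] fh pt by simp
    then have "eqv Z S (k \<cdot> x) (k \<cdot> y)" using weq_reflects[OF w] x y J(2) by simp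
    then show "eqv ?J S x y" using J(2) pt eq by simp
  next
    fix S a assume a: "eqv X S a a"
    note pa = eqv_pt(1)[OF a]
    obtain R p z where p: "covers p R S" and z: "eqv Z R z z" "eqv Y R (g \<cdot> z) ((f \<cdot> a) \<cdot> p)"
      using weq_surj[OF w hom_eqv[OF f a]] .
    obtain R' q d where q: "covers q R' R" and d: "eqv Z R' (z \<cdot> q) d" "g \<cdot> d = ((f \<cdot> a) \<cdot> p) \<cdot> q"
      using fibn_lift[OF g z] .
    note pq = covers_trans[OF q p]
    have apq: "eqv X R' (a \<cdot> (p \<cdot> q)) (a \<cdot> (p \<cdot> q))" by (rule eqv_cover[OF X pq a])
    have "f \<cdot> (a \<cdot> (p \<cdot> q)) = g \<cdot> d"
      using d(2) covers_assoc[OF q p Cmp_Mor[OF pa hom_Mor[OF f]]] hom_cover_assoc[OF f pq pa] by simp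
    then obtain y where y: "y \<in> pt R' ?Q" "h \<cdot> y = a \<cdot> (p \<cdot> q)" "k \<cdot> y = d"
      using pullback_lift[OF pb, of "a \<cdot> (p \<cdot> q)" "fst R'" d] eqv_pt(1)[OF apq] eqv_pt(2)[OF d(1)]
        MorD(2)[OF hom_Mor[OF f]] MorD(2)[OF hom_Mor[OF hg]] by auto
    have "eqv ?J R' y y" using J(2) y apq eqv_refl(2)[OF Z d(1)] by simp
    moreover have "eqv X R' (h \<cdot> y) (a \<cdot> (p \<cdot> q))" using y(2) apq by simp
    ultimately show "\<exists>R p x. covers p R S \<and> eqv ?J R x x \<and> eqv X R (h \<cdot> x) (a \<cdot> p)"
      using pq by blast
  qed
qed

text \<open>Paths in \<open>X\<close> are pairs of related elements, so the path object is the product \<open>Q\<close> with the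
  relation cut down to such pairs.\<close>

definition path_obj :: "'o \<times> 'p \<Rightarrow> 'o \<times> 'p \<Rightarrow> 'm \<Rightarrow> 'm \<Rightarrow> 'o \<times> 'p" where
  "path_obj X Q a b = (fst Q, snd Q \<sqinter>\<^bsub>Fib P (Prod C [fst Q, fst Q])\<^esub>
    inverse_pred (fst Q) a b (snd X))"

lemma fst_path_obj [simp]: "fst (path_obj X Q a b) = fst Q"
  by (simp add: path_obj_def)

lemma path_obj:
  assumes a: "hom Q X a" and b: "hom Q X b"
  shows "per (path_obj X Q a b)"
    and "eqv (path_obj X Q a b) S x y \<longleftrightarrow> eqv Q S x y \<and> eqv X S (a \<cdot> x) (b \<cdot> x)"
proof -
  note Q = hom_per(1)[OF a] and X = hom_per(2)[OF a]
  note ab = inverse_pred[OF per_rel_obj[OF X] hom_Mor[OF a] hom_Mor[OF b]]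
  have rel: "rel_obj (fst Q, snd Q)" "rel_obj (fst Q, inverse_pred (fst Q) a b (snd X))"
    using per_rel_obj[OF Q] ab(1) by (simp_all add: rel_obj_def)
  have end_points: "eqv X S (a \<cdot> x) (b \<cdot> y) \<longleftrightarrow> eqv X S (a \<cdot> x) (b \<cdot> x)" if "eqv Q S x y" for S x y
    using hom_eqv[OF b that] eqv_trans[OF X] eqv_sym[OF X] by blast
  have eqv: "eqv (path_obj X Q a b) S x y \<longleftrightarrow> eqv Q S x y \<and> eqv X S (a \<cdot> x) (b \<cdot> x)" for S x y
  proof -
    have "eqv (path_obj X Q a b) S x y \<longleftrightarrow> eqv Q S x y \<and>
        eqv (fst Q, inverse_pred (fst Q) a b (snd X)) S x y"
      using eqv_meet(2)[OF rel] by (simp add: path_obj_def)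
    also have "\<dots> \<longleftrightarrow> eqv Q S x y \<and> eqv X S (a \<cdot> x) (b \<cdot> y)"
      using ab(2)[of S x y] eqv_stage[of Q S x y] eqv_pt[of Q S x y]
      by (auto simp: eqv_def[of "(fst Q, _)"])
    finally show ?thesis using end_points by blast
  qed
  then show "eqv (path_obj X Q a b) S x y \<longleftrightarrow> eqv Q S x y \<and> eqv X S (a \<cdot> x) (b \<cdot> x)" .
  have "rel_obj (path_obj X Q a b)" using eqv_meet(1)[OF rel] by (simp add: path_obj_def)
  moreover have "eqv X S (a \<cdot> y) (b \<cdot> y)" if "eqv Q S x y" "eqv X S (a \<cdot> x) (b \<cdot> x)" for S x y
    using eqv_trans[OF X eqv_sym[OF X hom_eqv[OF a that(1)]]] end_points[OF that(1)] that(2) by blast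
  ultimately show "per (path_obj X Q a b)"
    unfolding per_def eqv using eqv_sym[OF Q] eqv_trans[OF Q] by blast
qed

text \<open>A pair related componentwise to a pair of related elements consists of related elements, so
  it is a path already and the lift is the pair itself.\<close>

lemma path_obj_fibn:
  assumes a: "hom Q X a" and b: "hom Q X b"
  shows "fibn (path_obj X Q a b) Q (Idn C (fst Q))"
proof -
  let ?P = "path_obj X Q a b" and ?i = "Idn C (fst Q)"
  note Q = hom_per(1)[OF a] and eqv = path_obj(2)[OF a b]
  have i: "?i \<cdot> x = x" if "x \<in> pt S (fst Q)" for S x using Idn_Cmp[OF that] .
  have "hom ?P Q ?i"
    using hom_id[OF Q] path_obj(1)[OF a b] unfolding hom_def eqv fst_path_obj by blast
  then show ?thesis
  proof (rule fibnI)
    fix S x u assume x: "eqv ?P S x x" and xu: "eqv Q S (?i \<cdot> x) u"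
    note pt = eqv_pt(1)[OF x, unfolded fst_path_obj]
    obtain p where p: "covers p S S" "\<And>x A. x \<in> pt S A \<Longrightarrow> x \<cdot> p = x"
      using covers_self[OF eqv_stage[OF x]] by blast
    have "eqv ?P S (x \<cdot> p) u" using xu x i[OF pt] p(2)[OF pt] unfolding eqv by simp
    moreover have "?i \<cdot> u = u \<cdot> p" using i p(2) eqv_pt(2)[OF xu] by simp
    ultimately show "\<exists>R p y. covers p R S \<and> eqv ?P R (x \<cdot> p) y \<and> ?i \<cdot> y = u \<cdot> p" using p(1) by blast
  qed
qed

text \<open>A path \<open>u\<close> is related to the constant path at its end point \<open>a u\<close>.\<close>

lemma path_obj_weq:
  assumes a: "hom Q X a" and b: "hom Q X b" and d: "hom X Q d"
    and ad: "a \<cdot> d = Idn C (fst X)" and bd: "b \<cdot> d = Idn C (fst X)"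
    and Q_eqv: "\<And>S x y. \<lbrakk>x \<in> pt S (fst Q); y \<in> pt S (fst Q); eqv X S (a \<cdot> x) (a \<cdot> y);
      eqv X S (b \<cdot> x) (b \<cdot> y)\<rbrakk> \<Longrightarrow> eqv Q S x y"
  shows "weq X (path_obj X Q a b) d"
proof -
  let ?P = "path_obj X Q a b"
  note Q = hom_per(1)[OF a] and X = hom_per(2)[OF a] and eqv = path_obj(2)[OF a b]
  have adx: "a \<cdot> (d \<cdot> x) = x" "b \<cdot> (d \<cdot> x) = x" if "x \<in> pt S (fst X)" for S x
    using comp_pt[OF d a that] comp_pt[OF d b that] ad bd Idn_Cmp[OF that] by simp_all
  have "eqv ?P S (d \<cdot> x) (d \<cdot> y)" if xy: "eqv X S x y" for S x y
    unfolding eqv using hom_eqv[OF d xy] adx[OF eqv_pt(1)[OF xy]] eqv_refl[OF X xy] by simp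
  then have "hom X ?P d" using X path_obj(1)[OF a b] hom_Mor[OF d] by (simp add: hom_def)
  then show ?thesis
  proof (rule weqI)
    fix S x y assume x: "eqv X S x x" and y: "eqv X S y y" and eq: "eqv ?P S (d \<cdot> x) (d \<cdot> y)"
    have "eqv X S (a \<cdot> (d \<cdot> x)) (a \<cdot> (d \<cdot> y))" using hom_eqv[OF a] eq unfolding eqv by blast
    then show "eqv X S x y" using adx eqv_pt(1)[OF x] eqv_pt(1)[OF y] by simp
  next
    fix S u assume u: "eqv ?P S u u"
    then have uQ: "eqv Q S u u" and path: "eqv X S (a \<cdot> u) (b \<cdot> u)" unfolding eqv by auto
    note pu = eqv_pt(1)[OF uQ] and pa = eqv_pt(1)[OF path]
    obtain p where p: "covers p S S" "\<And>x A. x \<in> pt S A \<Longrightarrow> x \<cdot> p = x"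
      using covers_self[OF eqv_stage[OF u]] by blast
    have au: "eqv X S (a \<cdot> u) (a \<cdot> u)" by (rule hom_eqv[OF a uQ])
    have "eqv Q S (d \<cdot> (a \<cdot> u)) u"
      using Q_eqv[OF Cmp_Mor[OF pa hom_Mor[OF d]] pu] adx[OF pa] au path by simp
    moreover have "eqv X S (a \<cdot> (d \<cdot> (a \<cdot> u))) (b \<cdot> (d \<cdot> (a \<cdot> u)))" using adx[OF pa] au by simp
    ultimately have "eqv ?P S (d \<cdot> (a \<cdot> u)) (u \<cdot> p)" unfolding eqv p(2)[OF pu] by blast
    then show "\<exists>R p x. covers p R S \<and> eqv X R x x \<and> eqv ?P R (d \<cdot> x) (u \<cdot> p)"
      using p(1) au by blast
  qed
qed

end


section \<open>The category of fibrant objects\<close>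

context frame_language
begin

lemma Ob_per: "X \<in> Ob (per_cat C P) \<longleftrightarrow> per X"
  by (cases X) (simp add: per_cat_def Let_def per_iff)

lemma Ar_per: "(X, f, Y) \<in> Ar (per_cat C P) \<longleftrightarrow> hom X Y f"
proof -
  have "(X, f, Y) \<in> Ar (per_cat C P) \<longleftrightarrow>
      X \<in> Ob (per_cat C P) \<and> Y \<in> Ob (per_cat C P) \<and> compatible C P X Y f"
    by (simp add: per_cat_def Let_def)
  then show ?thesis using compatible_iff hom_per unfolding Ob_per by blast
qed

lemma per_cat_simps [simp]:
  "Src (per_cat C P) (X, f, Y) = X" "Tgt (per_cat C P) (X, f, Y) = Y"
  "Idn (per_cat C P) X = (X, Idn C (fst X), X)"
  "(Y', g, Z) \<cdot>\<^bsub>per_cat C P\<^esub> (X, f, Y) = (X, g \<cdot> f, Z)"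
  by (simp_all add: per_cat_def Let_def)

lemma Mor_per: "F \<in> Mor (per_cat C P) X Y \<longleftrightarrow> (\<exists>f. F = (X, f, Y) \<and> hom X Y f)"
  by (cases F) (auto simp: Mor_def Ar_per)

lemma Mor_perI: "hom X Y f \<Longrightarrow> (X, f, Y) \<in> Mor (per_cat C P) X Y"
  by (simp add: Mor_per)

lemma fibrations_iff: "(X, f, Y) \<in> fibrations C P \<longleftrightarrow> fibn X Y f"
  using lifts_iff[of X Y f] by (auto simp: fibrations_def fibn_def Ar_per)

lemma weak_equivalences_iff: "(X, f, Y) \<in> weak_equivalences C P \<longleftrightarrow> weq X Y f"
  using reflects_iff[of X Y f] ess_surj_iff[of X Y f]
  by (auto simp: weak_equivalences_def weq_def Ar_per)

lemma category_per_cat: "category (per_cat C P)"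
proof
  fix F assume "F \<in> Ar (per_cat C P)"
  moreover obtain X f Y where "F = (X, f, Y)" by (cases F)
  ultimately show "Src (per_cat C P) F \<in> Ob (per_cat C P)" "Tgt (per_cat C P) F \<in> Ob (per_cat C P)"
    using hom_per by (simp_all add: Ar_per Ob_per)
next
  fix X assume "X \<in> Ob (per_cat C P)"
  then show "Idn (per_cat C P) X \<in> Mor (per_cat C P) X X" by (simp add: Mor_per Ob_per hom_id)
next
  fix F G X Y Z assume "F \<in> Mor (per_cat C P) X Y" "G \<in> Mor (per_cat C P) Y Z"
  then show "G \<cdot>\<^bsub>per_cat C P\<^esub> F \<in> Mor (per_cat C P) X Z" using hom_comp[of X Y _ Z] by (auto simp: Mor_per)
next
  fix F X Y assume "F \<in> Mor (per_cat C P) X Y"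
  then show "F \<cdot>\<^bsub>per_cat C P\<^esub> Idn (per_cat C P) X = F" "Idn (per_cat C P) Y \<cdot>\<^bsub>per_cat C P\<^esub> F = F"
    using Cmp_Idn[OF hom_Mor[of X Y]] Idn_Cmp[OF hom_Mor[of X Y]] by (auto simp: Mor_per)
next
  fix F G H X Y Z V
  assume "F \<in> Mor (per_cat C P) X Y" "G \<in> Mor (per_cat C P) Y Z" "H \<in> Mor (per_cat C P) Z V"
  then show "(H \<cdot>\<^bsub>per_cat C P\<^esub> G) \<cdot>\<^bsub>per_cat C P\<^esub> F = H \<cdot>\<^bsub>per_cat C P\<^esub> (G \<cdot>\<^bsub>per_cat C P\<^esub> F)"
    using Cmp_assoc[OF hom_Mor[of X Y] hom_Mor[of Y Z] hom_Mor[of Z V]] by (auto simp: Mor_per)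
qed

lemma is_iso_per:
  assumes "is_iso (per_cat C P) (X, f, Y)"
  obtains g where "hom X Y f" "hom Y X g" "g \<cdot> f = Idn C (fst X)" "f \<cdot> g = Idn C (fst Y)"
  using assms unfolding is_iso_def by (auto simp: Mor_per Ar_per)

lemma is_iso_weq_fibn:
  assumes "is_iso (per_cat C P) (X, f, Y)"
  shows "weq X Y f" "fibn X Y f"
  using is_iso_per[OF assms] iso_weq_fibn by metis+

definition terminal_per :: "'o \<times> 'p" where
  "terminal_per = (Prod C [], \<top>\<^bsub>Fib P (Prod C [Prod C [], Prod C []])\<^esub>)"

lemma terminal_base: "is_terminal C (Prod C [])"
  using product[of "[]"] by (simp add: is_product_def is_terminal_def)

lemma terminal_per: "is_terminal (per_cat C P) terminal_per"
proof -
  let ?T = "Prod C []"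
  have T: "?T \<in> Ob C" using terminal_base by (simp add: is_terminal_def)
  have eqv: "eqv terminal_per S x y \<longleftrightarrow> stage S \<and> x \<in> pt S ?T \<and> y \<in> pt S ?T" for S x y
    using holds_top[OF _ pair_Mor(1), of S x ?T y ?T] by (auto simp: eqv_def terminal_per_def)
  have "rel_obj terminal_per"
    using T top_Pred[OF Prod_Ob, of "[?T, ?T]"] by (simp add: rel_obj_def terminal_per_def)
  then have per: "per terminal_per" unfolding per_def eqv by blast
  have hom: "hom X terminal_per f \<longleftrightarrow> f \<in> Mor C (fst X) ?T" if X: "per X" for X f
  proof -
    have "eqv terminal_per S (f \<cdot> x) (f \<cdot> y)" if "f \<in> Mor C (fst X) ?T" "eqv X S x y" for S x y
      unfolding eqv using eqv_stage[OF that(2)] Cmp_Mor[OF _ that(1)] eqv_pt[OF that(2)] by blast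
    then show ?thesis using X per by (auto simp: hom_def terminal_per_def)
  qed
  have "\<exists>!F. F \<in> Mor (per_cat C P) X terminal_per" if X: "per X" for X
  proof -
    have "fst X \<in> Ob C" using X by (simp add: per_def rel_obj_def)
    then have "\<exists>!f. f \<in> Mor C (fst X) ?T" using terminal_base by (simp add: is_terminal_def)
    then show ?thesis unfolding Mor_per hom[OF X] by blast
  qed
  then show ?thesis using per by (simp add: is_terminal_def Ob_per)
qed

text \<open>Pullbacks are computed in the base category.  The relation is the largest one that makes the
  projections compatible, so that compatibility of an induced map can be tested on components.\<close>

lemma per_pullback:
  assumes f: "hom X Y f" and g: "hom Z Y g" and pb: "is_pullback C f g h k"
  defines "J \<equiv> joint (Src C h) h X k Z"
  shows "is_pullback (per_cat C P) (X, f, Y) (Z, g, Y) (J, h, X) (J, k, Z)"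
proof -
  let ?Q = "Src C h"
  have X: "per X" and Z: "per Z" using hom_per f g by blast+
  have h: "h \<in> Mor C ?Q (fst X)" and k: "k \<in> Mor C ?Q (fst Z)" and comm: "f \<cdot> h = g \<cdot> k"
    using pb hom_Mor[OF f] hom_Mor[OF g] by (auto simp: is_pullback_def Mor_def)
  note hJ = joint_hom[OF X Z h k, folded J_def]
  show ?thesis
  proof (rule category.is_pullbackI[OF category_per_cat Mor_perI[OF f] Mor_perI[OF g]
        Mor_perI[OF hJ(1)] Mor_perI[OF hJ(2)]])
    show "(X, f, Y) \<cdot>\<^bsub>per_cat C P\<^esub> (J, h, X) = (Z, g, Y) \<cdot>\<^bsub>per_cat C P\<^esub> (J, k, Z)"
      using comm by simp
  next
    fix V U W assume "U \<in> Mor (per_cat C P) V X" "W \<in> Mor (per_cat C P) V Z"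
      and eq: "(X, f, Y) \<cdot>\<^bsub>per_cat C P\<^esub> U = (Z, g, Y) \<cdot>\<^bsub>per_cat C P\<^esub> W"
    then obtain u w where U: "U = (V, u, X)" "hom V X u" and W: "W = (V, w, Z)" "hom V Z w"
      unfolding Mor_per by blast
    have "f \<cdot> u = g \<cdot> w" using eq U(1) W(1) by simp
    then obtain v where v: "v \<in> Mor C (fst V) ?Q" "h \<cdot> v = u" "k \<cdot> v = w"
      using pullback_lift[OF pb, of u "fst V" w] hom_Mor[OF U(2)] hom_Mor[OF W(2)]
        MorD(2)[OF hom_Mor[OF f]] MorD(2)[OF hom_Mor[OF g]] by auto
    have "hom V J v" unfolding J_def using hom_joint[OF X Z h k v(1)] v(2,3) U(2) W(2) by simp
    then show "\<exists>v. v \<in> Mor (per_cat C P) V J \<and> (J, h, X) \<cdot>\<^bsub>per_cat C P\<^esub> v = U \<and>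
        (J, k, Z) \<cdot>\<^bsub>per_cat C P\<^esub> v = W"
      using U(1) W(1) v(2,3) by (intro exI[of _ "(V, v, J)"]) (simp add: Mor_per)
  next
    fix V F F'
    assume "F \<in> Mor (per_cat C P) V J" "F' \<in> Mor (per_cat C P) V J"
      and eq: "(J, h, X) \<cdot>\<^bsub>per_cat C P\<^esub> F = (J, h, X) \<cdot>\<^bsub>per_cat C P\<^esub> F'"
        "(J, k, Z) \<cdot>\<^bsub>per_cat C P\<^esub> F = (J, k, Z) \<cdot>\<^bsub>per_cat C P\<^esub> F'"
    then obtain v w where v: "F = (V, v, J)" "hom V J v" and w: "F' = (V, w, J)" "hom V J w"
      unfolding Mor_per by blast
    have vw: "v \<in> Mor C (fst V) ?Q" "w \<in> Mor C (fst V) ?Q"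
      using hom_Mor[OF v(2)] hom_Mor[OF w(2)] by (simp_all add: J_def)
    have "h \<cdot> v = h \<cdot> w" "k \<cdot> v = k \<cdot> w" using eq v(1) w(1) by simp_all
    moreover have "f \<cdot> (h \<cdot> v) = g \<cdot> (k \<cdot> v)"
      using Cmp_assoc[OF vw(1) h hom_Mor[OF f]] Cmp_assoc[OF vw(1) k hom_Mor[OF g]] comm by simp
    ultimately have "v = w"
      using pullback_lift[OF pb, of "h \<cdot> v" "fst V" "k \<cdot> v"] vw Cmp_Mor[OF vw(1) h]
        Cmp_Mor[OF vw(1) k] MorD(2)[OF hom_Mor[OF f]] MorD(2)[OF hom_Mor[OF g]] by auto
    then show "F = F'" using v(1) w(1) by simp
  qed
qed

lemma per_pullback_exists:
  assumes "F \<in> Mor (per_cat C P) X Y" "G \<in> Mor (per_cat C P) Z Y"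
  shows "\<exists>H K. is_pullback (per_cat C P) F G H K"
proof -
  obtain f g where f: "F = (X, f, Y)" "hom X Y f" and g: "G = (Z, g, Y)" "hom Z Y g"
    using assms unfolding Mor_per by blast
  obtain h k where "is_pullback C f g h k"
    using finite_limits_pullback[OF finite_limits hom_Mor[OF f(2)] hom_Mor[OF g(2)]] .
  then show ?thesis using per_pullback[OF f(2) g(2)] f(1) g(1) by blast
qed

text \<open>A property of morphisms that holds of the pullbacks computed above, is satisfied by
  isomorphisms and closed under composition, holds of all pullbacks.\<close>

lemma pullback_fibrations:
  assumes pb: "is_pullback (per_cat C P) F G H K" and G: "G \<in> fibrations C P"
  shows "H \<in> fibrations C P"
    and "G \<in> weak_equivalences C P \<Longrightarrow> H \<in> weak_equivalences C P"
proof -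
  interpret per: category "per_cat C P" by (rule category_per_cat)
  obtain X Y Z Q where "F \<in> Mor (per_cat C P) X Y" "G \<in> Mor (per_cat C P) Z Y"
    "H \<in> Mor (per_cat C P) Q X"
    using per.pullbackD[OF pb] by metis
  then obtain f g h where F: "F = (X, f, Y)" "hom X Y f" and G': "G = (Z, g, Y)" "hom Z Y g"
    and H: "H = (Q, h, X)" "hom Q X h"
    unfolding Mor_per by blast
  have g: "fibn Z Y g" using G G'(1) by (simp add: fibrations_iff)
  obtain h' k' where pb': "is_pullback C f g h' k'"
    using finite_limits_pullback[OF finite_limits hom_Mor[OF F(2)] hom_Mor[OF G'(2)]] .
  let ?J = "joint (Src C h') h' X k' Z"
  obtain I where I: "is_iso (per_cat C P) I"
    "I \<in> Mor (per_cat C P) (Src (per_cat C P) H) (Src (per_cat C P) (?J, h', X))"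
    "(?J, h', X) \<cdot>\<^bsub>per_cat C P\<^esub> I = H" "(?J, k', Z) \<cdot>\<^bsub>per_cat C P\<^esub> I = K"
    by (rule per.pullback_unique_iso[OF pb per_pullback[OF F(2) G'(2) pb', folded F(1) G'(1)]])
  then obtain i where i: "I = (Q, i, ?J)" unfolding Mor_per H(1) per_cat_simps by blast
  have h: "h = h' \<cdot> i" using I(3) i H(1) by simp
  note iso = is_iso_weq_fibn[OF I(1)[unfolded i]]
  show "H \<in> fibrations C P"
    using fibn_comp[OF iso(2) pullback_fibn[OF F(2) g pb']] by (simp add: H(1) h fibrations_iff)
  assume "G \<in> weak_equivalences C P"
  then have "weq Z Y g" by (simp add: G'(1) weak_equivalences_iff)
  from weq_comp[OF iso(1) pullback_weq[OF F(2) g this pb']]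
  show "H \<in> weak_equivalences C P" by (simp add: H(1) h weak_equivalences_iff)
qed

text \<open>A product of \<open>X\<close> with itself need not be a chosen one, but it still carries the componentwise
  relation: its base object with that relation maps to it over the projections, and by uniqueness
  the underlying map is the identity.\<close>

lemma product_eqv:
  assumes prod: "is_product (per_cat C P) {0, 1 :: nat} (\<lambda>_. X) Q p"
    and p: "p 0 = (Q, a, X)" "p 1 = (Q, b, X)" and a: "hom Q X a" and b: "hom Q X b"
    and xy: "x \<in> pt S (fst Q)" "y \<in> pt S (fst Q)" "eqv X S (a \<cdot> x) (a \<cdot> y)" "eqv X S (b \<cdot> x) (b \<cdot> y)"
  shows "eqv Q S x y"
proof -
  let ?J = "joint (fst Q) a X b X" and ?i = "Idn C (fst Q)"
  note X = hom_per(2)[OF a] and Q = hom_per(1)[OF a]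
  note ab = hom_Mor[OF a] hom_Mor[OF b]
  note J = joint[OF X X ab] and hJ = joint_hom[OF X X ab]
  have Q_Ob: "fst Q \<in> Ob C" by (rule Mor_Ob(1)[OF ab(1)])
  have id: "a \<cdot> ?i = a" "b \<cdot> ?i = b" using Cmp_Idn ab by blast+
  have i: "hom Q ?J ?i" using hom_joint[OF X X ab, of ?i Q] Idn_Mor[OF Q_Ob] a b id by simp
  have univ: "\<exists>!M. M \<in> Mor (per_cat C P) Z Q \<and> p 0 \<cdot>\<^bsub>per_cat C P\<^esub> M = (Z, u, X) \<and>
      p 1 \<cdot>\<^bsub>per_cat C P\<^esub> M = (Z, v, X)" if "hom Z X u" "hom Z X v" for Z u v
  proof -
    have "Z \<in> Ob (per_cat C P)" using hom_per(1)[OF that(1)] by (simp add: Ob_per)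
    moreover define U where "U = (\<lambda>j :: nat. if j = 0 then (Z, u, X) else (Z, v, X))"
    have "\<forall>j\<in>{0, 1}. U j \<in> Mor (per_cat C P) Z X"
      using that by (simp add: Mor_per U_def)
    ultimately have "\<exists>!M. M \<in> Mor (per_cat C P) Z Q \<and> (\<forall>j\<in>{0, 1}. p j \<cdot>\<^bsub>per_cat C P\<^esub> M = U j)"
      using prod unfolding is_product_def by blast
    then show ?thesis by (simp add: U_def)
  qed
  obtain M where "M \<in> Mor (per_cat C P) ?J Q" and M: "p 0 \<cdot>\<^bsub>per_cat C P\<^esub> M = (?J, a, X)"
      "p 1 \<cdot>\<^bsub>per_cat C P\<^esub> M = (?J, b, X)"
    using ex1_implies_ex[OF univ[OF hJ]] by blast
  then obtain m where m': "M = (?J, m, Q)" and hm: "hom ?J Q m" unfolding Mor_per by blast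
  have m: "hom ?J Q m" "a \<cdot> m = a" "b \<cdot> m = b" using M hm p unfolding m' by simp_all
  have mM: "m \<in> Mor C (fst Q) (fst Q)" using hom_Mor[OF m(1)] by simp
  have "hom Q Q m" using hom_comp[OF i m(1)] Cmp_Idn[OF mM] by simp
  then have "(Q, m, Q) \<in> Mor (per_cat C P) Q Q \<and> p 0 \<cdot>\<^bsub>per_cat C P\<^esub> (Q, m, Q) = (Q, a, X) \<and>
      p 1 \<cdot>\<^bsub>per_cat C P\<^esub> (Q, m, Q) = (Q, b, X)"
    using m p by (simp add: Mor_per)
  moreover have "(Q, ?i, Q) \<in> Mor (per_cat C P) Q Q \<and> p 0 \<cdot>\<^bsub>per_cat C P\<^esub> (Q, ?i, Q) = (Q, a, X) \<and>
      p 1 \<cdot>\<^bsub>per_cat C P\<^esub> (Q, ?i, Q) = (Q, b, X)"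
    using id p hom_id[OF Q] by (simp add: Mor_per)
  ultimately have "(Q, m, Q) = (Q, ?i, Q)" using univ[OF a b] by blast
  then have "m = ?i" by simp
  moreover have "eqv ?J S x y" using J(2) xy by simp
  ultimately show ?thesis using hom_eqv[OF m(1)] Idn_Cmp xy(1,2) by metis
qed

lemma terminal_hom_ex1:
  assumes "is_terminal (per_cat C P) T" "per X"
  shows "\<exists>!f. hom X T f"
proof -
  have "\<exists>!F. F \<in> Mor (per_cat C P) X T"
    using assms unfolding is_terminal_def by (simp add: Ob_per)
  then show ?thesis unfolding Mor_per by blast
qed

text \<open>Over a terminal object there is nothing to lift: all its elements at a stage coincide.\<close>

lemma terminal_fibn:
  assumes T: "is_terminal (per_cat C P) T" and f: "hom X T f"
  shows "fibn X T f"
proof (rule fibnI[OF f])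
  let ?E = "Prod C []"
  have per: "per T" "per terminal_per"
    using T terminal_per by (simp_all add: is_terminal_def Ob_per)
  \<comment> \<open>\<open>T\<close> is a retract of an object over a terminal object of the base category\<close>
  obtain i j where i: "hom terminal_per T i" and j: "hom T terminal_per j"
    using terminal_hom_ex1[OF T per(2)] terminal_hom_ex1[OF terminal_per per(1)] by blast
  have ij: "i \<cdot> j = Idn C (fst T)"
    using terminal_hom_ex1[OF T per(1)] hom_comp[OF j i] hom_id[OF per(1)] by blast
  have collapse: "u = v" if "u \<in> pt S (fst T)" "v \<in> pt S (fst T)" for S u v
  proof -
    have "j \<cdot> u \<in> pt S ?E" "j \<cdot> v \<in> pt S ?E"
      using Cmp_Mor that hom_Mor[OF j] by (simp_all add: terminal_per_def)
    then have "j \<cdot> u = j \<cdot> v"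
      using terminal_base Mor_Ob(1)[OF that(1)] unfolding is_terminal_def by blast
    then have "(i \<cdot> j) \<cdot> u = (i \<cdot> j) \<cdot> v" using comp_pt[OF j i] that by simp
    then show ?thesis using ij Idn_Cmp that by metis
  qed
  fix S x u assume x: "eqv X S x x" and fxu: "eqv T S (f \<cdot> x) u"
  note px = eqv_pt(1)[OF x]
  obtain p where p: "covers p S S" "\<And>x A. x \<in> pt S A \<Longrightarrow> x \<cdot> p = x"
    using covers_self[OF eqv_stage[OF x]] by blast
  have "eqv X S (x \<cdot> p) x" using x p(2)[OF px] by simp
  moreover have "f \<cdot> x = u \<cdot> p" using collapse[OF eqv_pt[OF fxu]] p(2)[OF eqv_pt(2)[OF fxu]] by simp
  ultimately show "\<exists>R p y. covers p R S \<and> eqv X R (x \<cdot> p) y \<and> f \<cdot> y = u \<cdot> p" using p(1) by blast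
qed

theorem category_of_fibrant_objects_per_cat:
  "category_of_fibrant_objects (per_cat C P) (fibrations C P) (weak_equivalences C P)"
proof -
  interpret per: category "per_cat C P" by (rule category_per_cat)
  show ?thesis
  proof
    show "fibrations C P \<subseteq> Ar (per_cat C P)" "weak_equivalences C P \<subseteq> Ar (per_cat C P)"
      by (auto simp: fibrations_def weak_equivalences_def)
    show "has_finite_products (per_cat C P)"
      by (rule per.finite_products_from_pullbacks[OF terminal_per per_pullback_exists])
  next
    fix F assume iso: "is_iso (per_cat C P) F"
    obtain X f Y where F: "F = (X, f, Y)" by (cases F)
    show "F \<in> weak_equivalences C P" "F \<in> fibrations C P"
      using is_iso_weq_fibn[OF iso[unfolded F]] by (simp_all add: F weak_equivalences_iff fibrations_iff)
  next
    fix F G X Y Z assume "F \<in> Mor (per_cat C P) X Y" "G \<in> Mor (per_cat C P) Y Z"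
    then obtain f g where F: "F = (X, f, Y)" "hom X Y f" and G: "G = (Y, g, Z)" "hom Y Z g"
      unfolding Mor_per by blast
    have GF: "G \<cdot>\<^bsub>per_cat C P\<^esub> F = (X, g \<cdot> f, Z)" by (simp add: F(1) G(1))
    note simps = F(1) G(1) GF[unfolded F(1) G(1)] weak_equivalences_iff fibrations_iff
    show "G \<cdot>\<^bsub>per_cat C P\<^esub> F \<in> weak_equivalences C P"
      if "F \<in> weak_equivalences C P" "G \<in> weak_equivalences C P"
      using that weq_comp by (simp add: simps)
    show "G \<in> weak_equivalences C P"
      if "F \<in> weak_equivalences C P" "G \<cdot>\<^bsub>per_cat C P\<^esub> F \<in> weak_equivalences C P"
      using that weq_cancel_right[OF _ G(2)] by (simp add: simps)
    show "F \<in> weak_equivalences C P"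
      if "G \<in> weak_equivalences C P" "G \<cdot>\<^bsub>per_cat C P\<^esub> F \<in> weak_equivalences C P"
      using that weq_cancel_left[OF F(2)] by (simp add: simps)
    show "G \<cdot>\<^bsub>per_cat C P\<^esub> F \<in> fibrations C P"
      if "F \<in> fibrations C P" "G \<in> fibrations C P"
      using that fibn_comp by (simp add: simps)
  next
    fix F G A B D assume "F \<in> Mor (per_cat C P) A B" "G \<in> Mor (per_cat C P) D B"
    then show "\<exists>h k. is_pullback (per_cat C P) F G h k" by (rule per_pullback_exists)
  next
    fix F G H K assume "is_pullback (per_cat C P) F G H K" "G \<in> fibrations C P"
    then show "H \<in> fibrations C P" by (rule pullback_fibrations)
  next
    fix F G H K assume "is_pullback (per_cat C P) F G H K"
      "G \<in> fibrations C P \<inter> weak_equivalences C P"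
    then show "H \<in> fibrations C P \<inter> weak_equivalences C P" using pullback_fibrations by blast
  next
    fix X Q p \<Delta>
    assume "X \<in> Ob (per_cat C P)" and prod: "is_product (per_cat C P) {0, 1 :: nat} (\<lambda>_. X) Q p"
      and \<Delta>: "\<Delta> \<in> Mor (per_cat C P) X Q" "p 0 \<cdot>\<^bsub>per_cat C P\<^esub> \<Delta> = Idn (per_cat C P) X"
        "p 1 \<cdot>\<^bsub>per_cat C P\<^esub> \<Delta> = Idn (per_cat C P) X"
    have "p 0 \<in> Mor (per_cat C P) Q X" "p 1 \<in> Mor (per_cat C P) Q X"
      using prod by (simp_all add: is_product_def)
    then obtain a b d where p: "p 0 = (Q, a, X)" "p 1 = (Q, b, X)" and a: "hom Q X a" and b: "hom Q X b"
      and d: "\<Delta> = (X, d, Q)" "hom X Q d"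
      using \<Delta>(1) unfolding Mor_per by blast
    have ad: "a \<cdot> d = Idn C (fst X)" "b \<cdot> d = Idn C (fst X)"
      using \<Delta>(2,3) by (simp_all add: p[simplified] d(1))
    let ?P = "path_obj X Q a b"
    note w = path_obj_weq[OF a b d(2) ad product_eqv[OF prod p a b]]
      and f = path_obj_fibn[OF a b]
    have "Idn C (fst Q) \<cdot> d = d" using Idn_Cmp[OF hom_Mor[OF d(2)]] .
    then show "\<exists>PX\<in>Ob (per_cat C P). \<exists>s\<in>Mor (per_cat C P) X PX. \<exists>d\<in>Mor (per_cat C P) PX Q.
        s \<in> weak_equivalences C P \<and> d \<in> fibrations C P \<and> d \<cdot>\<^bsub>per_cat C P\<^esub> s = \<Delta>"
      using w f path_obj(1)[OF a b] weq_hom[OF w] fibn_hom[OF f]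
      by (intro bexI[of _ ?P] bexI[of _ "(X, d, ?P)"] bexI[of _ "(?P, Idn C (fst Q), Q)"])
        (simp_all add: Ob_per Mor_per weak_equivalences_iff fibrations_iff d(1))
  next
    fix T F X assume T: "is_terminal (per_cat C P) T" and "F \<in> Mor (per_cat C P) X T"
    then obtain f where "F = (X, f, T)" "hom X T f" unfolding Mor_per by blast
    then show "F \<in> fibrations C P" using terminal_fibn[OF T] by (simp add: fibrations_iff)
  qed
qed

end

theorem theorem4p7:
  fixes C :: "('o, 'm) pcat"
    and P :: "('o, 'm, 'p) idx"
  assumes "chosen_products C"
    and "indexed_frame C P"
  shows "category_of_fibrant_objects (per_cat C P) (fibrations C P) (weak_equivalences C P)"
proof -
  interpret frame_language C P
    using assms by (simp add: frame_language_def frame_language_axioms_def)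
  show ?thesis by (rule category_of_fibrant_objects_per_cat)
qed

end
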